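(* Let $\Omega$ be a metrizable locally compact space and let $p\in\partial^{(\infty)}(\Omega^\flat)$. Then there exists a well-ordered increasing chain $(\mathcal{Q}_\alpha:\alpha\in\mathfrak{c})$ of prime $z$-filters on $\Omega$, each supported at $p$. Furthermore, (for this chain) by setting $Q_\alpha=C_0(\Omega)\cap\mathbf{Z}^{-1}[\mathcal{Q}_\alpha]$ one obtains a well-ordered increasing chain $(Q_\alpha:\alpha\in\mathfrak{c})$ of prime $z$-ideals in $C_0(\Omega)$, each supported at $p$.
   Context: Topological spaces are Hausdorff. $\mathfrak{c}=2^{\aleph_0}$, identified with the smallest ordinal of that cardinality. A well-ordered increasing chain indexed by an ordinal $\kappa$ means a family with $\mathcal{Q}_\alpha\subsetneq\mathcal{Q}_\beta$ whenever $\alpha<\beta$ in $\kappa$. $\Omega^\flat$ is the one-point compactification of $\Omega$ (the added point is "the point at infinity"). $C(\Omega)$ is the algebra of continuous scalar-valued functions on $\Omega$ and $C_0(\Omega)$ the subalgebra of those vanishing at infinity (scalar field real or complex, fixed). For a compact space $K$, $\partial^{(1)}K=\partial K$ is the set of all limit points of $K$, $\partial^{(n+1)}K=\partial(\partial^{(n)}K)$ for $n\ge1$, and $\partial^{(\infty)}K=\bigcap_{n\ge1}\partial^{(n)}K$. $\mathbf{Z}(f)=f^{-1}(0)$ and $\mathbf{Z}[\Omega]=\{\mathbf{Z}(f):f\in C(\Omega)\}$. A $z$-filter on $\Omega$ is a non-empty proper subset of $\mathbf{Z}[\Omega]$ closed under finite intersections and under supersets belonging to $\mathbf{Z}[\Omega]$.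 A $z$-filter $\mathcal{P}$ is prime if $Z_1\cup Z_2\notin\mathcal{P}$ whenever $Z_1,Z_2\in\mathbf{Z}[\Omega]\setminus\mathcal{P}$. For a $z$-filter $\mathcal{F}$, $\mathbf{Z}^{-1}[\mathcal{F}]=\{f\in C(\Omega):\mathbf{Z}(f)\in\mathcal{F}\}$. An ideal $I$ of $C_0(\Omega)$ is a $z$-ideal if $g\in I$ whenever $g\in C_0(\Omega)$, $f\in I$ and $\mathbf{Z}(g)\supset\mathbf{Z}(f)$. Prime ideals are proper. A prime $z$-filter $\mathcal{P}$ is supported at $p\in\Omega$ if $p\in Z$ for all $Z\in\mathcal{P}$, and supported at the point at infinity if no such $p\in\Omega$ exists. A prime ideal $P$ of $C_0(\Omega)$ is supported at $p\in\Omega$ if $f(p)=0$ for all $f\in P$, and supported at infinity if no such $p\in\Omega$ exists. *)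

theory Defs
  imports "HOL-Analysis.Analysis"
begin

text \<open>
  The space \<open>\<Omega>\<close> is the type \<open>'a\<close> with its class topology. Its one-point
  compactification is the library's \<^const>\<open>Alexandroff_compactification\<close> on
  \<open>'a option\<close>, in which \<open>None\<close> is the point at infinity.

  The scalar field is a type \<open>'k\<close> of class \<^class>\<open>real_normed_field\<close>. The norm in that class is
  multiplicative, so by Ostrowski's theorem \<open>'k\<close> is, up to isometric isomorphism,
  either the reals or the complex numbers.
\<close>

primrec limit_points_iter :: "nat \<Rightarrow> 'a topology \<Rightarrow> 'a set" where
  "limit_points_iter 0 K = topspace K"
| "limit_points_iter (Suc n) K =
     (subtopology K (limit_points_iter n K)) derived_set_of (limit_points_iter n K)"

definition limit_points_inf :: "'a topology \<Rightarrow> 'a set" where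
  "limit_points_inf K = (\<Inter>n\<in>{1..}. limit_points_iter n K)"

definition continuum_ordinal :: "nat set rel" where
  "continuum_ordinal = card_of (UNIV :: nat set set)"
  \<comment> \<open>\<^const>\<open>card_of\<close> is a well-order of its argument of least possible order type,
     hence this is the initial ordinal of cardinality \<open>2\<close> to the aleph-zero.\<close>

definition increasing_chain :: "'i rel \<Rightarrow> ('i \<Rightarrow> 'b set) \<Rightarrow> bool" where
  "increasing_chain r Q \<longleftrightarrow> Well_order r \<and>
     (\<forall>\<alpha>\<in>Field r. \<forall>\<beta>\<in>Field r. (\<alpha>, \<beta>) \<in> r \<and> \<alpha> \<noteq> \<beta> \<longrightarrow> Q \<alpha> \<subset> Q \<beta>)"

definition C_all :: "('a::topological_space \<Rightarrow> 'k::real_normed_field) set" where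
  "C_all = {f. continuous_on UNIV f}"

definition C_0 :: "('a::topological_space \<Rightarrow> 'k::real_normed_field) set" where
  "C_0 = {f \<in> C_all. \<forall>\<epsilon>>0. compact {x. norm (f x) \<ge> \<epsilon>}}"

definition zero_set :: "('a \<Rightarrow> 'k::zero) \<Rightarrow> 'a set" where
  "zero_set f = {x. f x = 0}"

definition zero_sets :: "'k::real_normed_field itself \<Rightarrow> 'a::topological_space set set" where
  "zero_sets _ = zero_set ` (C_all :: ('a \<Rightarrow> 'k) set)"

definition z_filter ::
  "'k::real_normed_field itself \<Rightarrow> 'a::topological_space set set \<Rightarrow> bool" where
  "z_filter k F \<longleftrightarrow>
     F \<noteq> {} \<and> F \<subset> zero_sets k \<and>
     (\<forall>Z1\<in>F. \<forall>Z2\<in>F. Z1 \<inter> Z2 \<in> F) \<and>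
     (\<forall>Z1\<in>F. \<forall>Z2\<in>zero_sets k. Z1 \<subseteq> Z2 \<longrightarrow> Z2 \<in> F)"

definition prime_z_filter ::
  "'k::real_normed_field itself \<Rightarrow> 'a::topological_space set set \<Rightarrow> bool" where
  "prime_z_filter k P \<longleftrightarrow> z_filter k P \<and>
     (\<forall>Z1\<in>zero_sets k - P. \<forall>Z2\<in>zero_sets k - P. Z1 \<union> Z2 \<notin> P)"

definition zero_set_preimage ::
  "'a::topological_space set set \<Rightarrow> ('a \<Rightarrow> 'k::real_normed_field) set" where
  "zero_set_preimage F = {f \<in> C_all. zero_set f \<in> F}"

text \<open>
  The algebra \<^const>\<open>C_0\<close> has no unit unless the space is compact, so the unital rings of
  HOL-Algebra do not apply, and closure under scalar multiples is required explicitly.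
\<close>

definition C_0_ideal :: "('a::topological_space \<Rightarrow> 'k::real_normed_field) set \<Rightarrow> bool" where
  "C_0_ideal I \<longleftrightarrow>
     I \<subseteq> C_0 \<and> (\<lambda>x. 0) \<in> I \<and>
     (\<forall>f\<in>I. \<forall>g\<in>I. (\<lambda>x. f x + g x) \<in> I) \<and>
     (\<forall>c. \<forall>f\<in>I. (\<lambda>x. c * f x) \<in> I) \<and>
     (\<forall>f\<in>I. \<forall>g\<in>C_0. (\<lambda>x. f x * g x) \<in> I)"

definition C_0_prime_ideal :: "('a::topological_space \<Rightarrow> 'k::real_normed_field) set \<Rightarrow> bool" where
  "C_0_prime_ideal P \<longleftrightarrow> C_0_ideal P \<and> P \<noteq> C_0 \<and>
     (\<forall>f\<in>C_0. \<forall>g\<in>C_0. (\<lambda>x. f x * g x) \<in> P \<longrightarrow> f \<in> P \<or> g \<in> P)"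

definition C_0_z_ideal :: "('a::topological_space \<Rightarrow> 'k::real_normed_field) set \<Rightarrow> bool" where
  "C_0_z_ideal I \<longleftrightarrow> C_0_ideal I \<and>
     (\<forall>f\<in>I. \<forall>g\<in>C_0. zero_set f \<subseteq> zero_set g \<longrightarrow> g \<in> I)"

fun filter_supported_at :: "'a set set \<Rightarrow> 'a option \<Rightarrow> bool" where
  "filter_supported_at P (Some p) \<longleftrightarrow> (\<forall>Z\<in>P. p \<in> Z)"
| "filter_supported_at P None \<longleftrightarrow> \<not> (\<exists>p. \<forall>Z\<in>P. p \<in> Z)"

fun ideal_supported_at :: "('a \<Rightarrow> 'k::zero) set \<Rightarrow> 'a option \<Rightarrow> bool" where
  "ideal_supported_at P (Some p) \<longleftrightarrow> (\<forall>f\<in>P. f p = 0)"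
| "ideal_supported_at P None \<longleftrightarrow> \<not> (\<exists>p. \<forall>f\<in>P. f p = 0)"

end

theory Submission
  imports Defs
begin

text \<open>
  In a metrizable space the zero sets are the closed sets, so a prime \<open>z\<close>-filter consists of the
  closed members of an ultrafilter on the space. A whole chain of them is read off a single
  ultrafilter \<open>\<U>\<close> on the functions \<open>y\<close> from ordinals to points: the filter with index \<open>\<alpha>\<close>
  consists of the closed \<open>C\<close> such that \<open>y \<alpha> \<in> C\<close> for \<open>\<U>\<close>-almost all \<open>y\<close>. The chain is increasing
  once \<open>y \<alpha> \<in> C\<close> almost surely implies \<open>y \<beta> \<in> C\<close> for all \<open>\<alpha> < \<beta>\<close> and closed \<open>C\<close>, and it is
  strictly so if there are closed sets \<open>Z \<alpha>\<close> with \<open>y \<alpha> \<in> Z \<alpha>\<close> and \<open>y \<alpha> \<notin> Z \<beta>\<close> almost surely.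
  It remains to see that finitely many of these conditions can be satisfied at once.

  To this end choose points \<open>x n\<close> of the \<open>n\<close>-th derived set that accumulate only at \<open>p\<close>,
  disjoint balls around them, and in the \<open>n\<close>-th ball closed sets
  \<open>S n 0 \<supseteq> S n 1 \<supseteq> \<dots> \<supseteq> S n n \<ni> x n\<close>, each nowhere dense in its predecessor. Put
  \<open>Z \<alpha> = (\<Union>n. S n (f \<alpha> n))\<close>, together with \<open>p\<close> if \<open>p\<close> is a point of the space, where the \<open>f \<alpha>\<close>
  are continuum many independent functions. Given finitely many indices, some arbitrarily late
  ball has \<open>f \<alpha> n\<close> increasing in \<open>\<alpha>\<close>, and suitable \<open>y \<alpha>\<close> are found by descending from \<open>x n\<close>
  through the sets \<open>S n j\<close>. Finally, a function in \<open>C\<^sub>0\<close> that is positive on all the balls keeps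
  the ideals proper and distinct.
\<close>

section \<open>Ultrafilters and independent functions\<close>

text \<open>Zorn's lemma yields a maximal proper filter above \<open>\<B>\<close>. Adjoining a set
  \<open>A\<close> to it gives a proper filter again unless some member is disjoint from
  \<open>A\<close>, so maximality decides every set.\<close>

lemma ultrafilter_extending_base:
  assumes ne: "\<B> \<noteq> {}" "{} \<notin> \<B>"
    and dir: "\<And>A B. A \<in> \<B> \<Longrightarrow> B \<in> \<B> \<Longrightarrow> \<exists>C\<in>\<B>. C \<subseteq> A \<inter> B"
  obtains \<U> where "\<B> \<subseteq> \<U>" "{} \<notin> \<U>"
    "\<And>A B. A \<in> \<U> \<Longrightarrow> B \<in> \<U> \<Longrightarrow> A \<inter> B \<in> \<U>"
    "\<And>A B. A \<in> \<U> \<Longrightarrow> A \<subseteq> B \<Longrightarrow> B \<in> \<U>"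
    "\<And>A. A \<in> \<U> \<or> - A \<in> \<U>"
proof -
  define \<F> where "\<F> = {F. \<B> \<subseteq> F \<and> {} \<notin> F \<and> (\<forall>A\<in>F. \<forall>B\<in>F. A \<inter> B \<in> F)
    \<and> (\<forall>A\<in>F. \<forall>B. A \<subseteq> B \<longrightarrow> B \<in> F)}"
  have "\<exists>M\<in>\<F>. \<forall>X\<in>\<F>. M \<subseteq> X \<longrightarrow> X = M"
  proof (rule subset_Zorn_nonempty)
    \<comment> \<open>The upward closure of \<open>\<B>\<close> is a proper filter and shows that
      the family is inhabited.\<close>
    have "A \<inter> B \<in> {A. \<exists>C\<in>\<B>. C \<subseteq> A}"
      if AB: "A \<in> {A. \<exists>C\<in>\<B>. C \<subseteq> A}" "B \<in> {A. \<exists>C\<in>\<B>. C \<subseteq> A}" for A B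
    proof -
      obtain A' B' where "A' \<in> \<B>" "B' \<in> \<B>" "A' \<subseteq> A" "B' \<subseteq> B" using AB by blast
      moreover from dir[OF this(1,2)] obtain C where "C \<in> \<B>" "C \<subseteq> A' \<inter> B'" by blast
      ultimately show ?thesis by blast
    qed
    moreover have "\<B> \<subseteq> {A. \<exists>C\<in>\<B>. C \<subseteq> A}" by blast
    moreover have "{} \<notin> {A. \<exists>C\<in>\<B>. C \<subseteq> A}" using ne(2) by auto
    moreover have "B \<in> {A. \<exists>C\<in>\<B>. C \<subseteq> A}" if "A \<in> {A. \<exists>C\<in>\<B>. C \<subseteq> A}" "A \<subseteq> B" for A B
      using that by blast
    ultimately have "{A. \<exists>C\<in>\<B>. C \<subseteq> A} \<in> \<F>"
      unfolding \<F>_def by (intro CollectI conjI ballI allI impI) simp_all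
    then show "\<F> \<noteq> {}" by blast
  next
    fix \<C> assume nonempty: "\<C> \<noteq> {}" and ch: "subset.chain \<F> \<C>"
    have sub: "\<C> \<subseteq> \<F>" using ch by (simp add: subset.chain_def)
    have "A \<inter> B \<in> \<Union>\<C>" if AB: "A \<in> \<Union>\<C>" "B \<in> \<Union>\<C>" for A B
    proof -
      obtain F where F: "A \<in> F" "F \<in> \<C>" using AB(1) by (rule UnionE)
      obtain G where G: "B \<in> G" "G \<in> \<C>" using AB(2) by (rule UnionE)
      have "F \<subseteq> G \<or> G \<subseteq> F" using ch F(2) G(2) unfolding subset_chain_def by blast
      then obtain H where H: "A \<in> H" "B \<in> H" "H \<in> \<C>" using F G by blast
      then have "H \<in> \<F>" using sub by blast
      then have "A \<inter> B \<in> H" using H by (simp add: \<F>_def)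
      then show ?thesis using H(3) by blast
    qed
    moreover have "\<B> \<subseteq> \<Union>\<C>"
    proof -
      obtain F where "F \<in> \<C>" using nonempty by blast
      moreover from this have "\<B> \<subseteq> F" using sub by (auto simp: \<F>_def)
      ultimately show ?thesis by blast
    qed
    moreover have "{} \<notin> \<Union>\<C>" using sub by (auto simp: \<F>_def)
    moreover have "B \<in> \<Union>\<C>" if "A \<in> \<Union>\<C>" "A \<subseteq> B" for A B
    proof -
      obtain F where F: "A \<in> F" "F \<in> \<C>" using \<open>A \<in> \<Union>\<C>\<close> by (rule UnionE)
      moreover have "F \<in> \<F>" using F(2) sub by blast
      ultimately have "B \<in> F" using \<open>A \<subseteq> B\<close> by (simp add: \<F>_def)
      then show ?thesis using F(2) by blast
    qed
    ultimately show "\<Union>\<C> \<in> \<F>"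
      unfolding \<F>_def by (intro CollectI conjI ballI allI impI) simp_all
  qed
  then obtain U where U: "U \<in> \<F>" and max: "\<And>X. X \<in> \<F> \<Longrightarrow> U \<subseteq> X \<Longrightarrow> X = U" by blast
  have U_props: "\<B> \<subseteq> U" "{} \<notin> U" "\<And>A B. A \<in> U \<Longrightarrow> B \<in> U \<Longrightarrow> A \<inter> B \<in> U"
    "\<And>A B. A \<in> U \<Longrightarrow> A \<subseteq> B \<Longrightarrow> B \<in> U"
    using U by (simp_all add: \<F>_def)
  have "- A \<in> U" if A: "A \<notin> U" for A
  proof -
    \<comment> \<open>\<open>G\<close> is the filter generated by \<open>U\<close> and
      \<open>A\<close>. It contains \<open>A\<close>, which \<open>U\<close> does not, so it cannot
      be proper; hence some member of \<open>U\<close> lies in \<open>- A\<close>.\<close>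
    define G where "G = {X. \<exists>u\<in>U. u \<inter> A \<subseteq> X}"
    have GI: "X \<in> G" if "u \<in> U" "u \<inter> A \<subseteq> X" for u X using that by (auto simp: G_def)
    have UG: "U \<subseteq> G" using GI by blast
    obtain u where "u \<in> U" using U_props(1) ne(1) by blast
    then have "A \<in> G" using GI by blast
    then have "G \<notin> \<F>" using max[of G] UG A by blast
    moreover have "X \<inter> Y \<in> G" if XY: "X \<in> G" "Y \<in> G" for X Y
    proof -
      obtain u v where uv: "u \<in> U" "v \<in> U" "u \<inter> A \<subseteq> X" "v \<inter> A \<subseteq> Y"
        using XY unfolding G_def by blast
      show ?thesis using GI[OF U_props(3)[OF uv(1,2)]] uv(3,4) by blast
    qed
    moreover have "Y \<in> G" if "X \<in> G" "X \<subseteq> Y" for X Y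
      using that unfolding G_def by blast
    moreover have "\<B> \<subseteq> G" using UG U_props(1) by blast
    ultimately have "{} \<in> G"
      unfolding \<F>_def by (simp (no_asm_use)) blast
    then obtain u where "u \<in> U" "u \<subseteq> - A" unfolding G_def by blast
    then show ?thesis using U_props(4) by blast
  qed
  then have "A \<in> U \<or> - A \<in> U" for A by blast
  from that[OF U_props this] show thesis .
qed

text \<open>Hausdorff's independent functions: \<open>n\<close> codes a table of prescribed values indexed by
  the traces of sets on an initial segment of the naturals.\<close>

lemma independent_functions:
  obtains f :: "nat set \<Rightarrow> nat \<Rightarrow> nat" where "\<And>\<alpha> n. f \<alpha> n \<le> n"
    "\<And>A h N. finite A \<Longrightarrow> \<exists>n\<ge>N. \<forall>\<alpha>\<in>A. f \<alpha> n = h \<alpha>"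
proof -
  define code :: "nat \<Rightarrow> nat \<times> nat \<times> nat list" where "code = from_nat"
  \<comment> \<open>The cap \<open>min n\<close> enforces \<open>f \<alpha> n \<le> n\<close>;
    \<open>set_encode\<close> turns the trace of \<open>\<alpha>\<close> below \<open>m\<close> into
    a position in the table \<open>L\<close>.\<close>
  define f :: "nat set \<Rightarrow> nat \<Rightarrow> nat" where
    "f \<alpha> n = (case code n of (_, m, L) \<Rightarrow> min n (L ! set_encode (\<alpha> \<inter> {..<m})))" for \<alpha> n
  have prescribe: "\<exists>n\<ge>N. \<forall>\<alpha>\<in>A. f \<alpha> n = h \<alpha>" if fin: "finite A" for A h N
  proof -
    have "\<exists>m. \<forall>\<alpha>\<in>A. \<forall>\<beta>\<in>A. \<alpha> \<noteq> \<beta> \<longrightarrow> \<alpha> \<inter> {..<m} \<noteq> \<beta> \<inter> {..<m}"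
    proof -
      define k where "k \<alpha> \<beta> = (SOME k. (k \<in> \<alpha>) \<noteq> (k \<in> \<beta>))" for \<alpha> \<beta> :: "nat set"
      have k: "(k \<alpha> \<beta> \<in> \<alpha>) \<noteq> (k \<alpha> \<beta> \<in> \<beta>)" if "\<alpha> \<noteq> \<beta>" for \<alpha> \<beta>
        unfolding k_def by (rule someI_ex) (use that in blast)
      have "finite (case_prod k ` (A \<times> A))" using fin by simp
      then obtain m where m: "\<And>j. j \<in> case_prod k ` (A \<times> A) \<Longrightarrow> j < m"
        by (meson finite_nat_set_iff_bounded)
      have "\<alpha> \<inter> {..<m} \<noteq> \<beta> \<inter> {..<m}" if "\<alpha> \<in> A" "\<beta> \<in> A" "\<alpha> \<noteq> \<beta>" for \<alpha> \<beta>
      proof -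
        have "k \<alpha> \<beta> < m" using m that by (metis (no_types, lifting) SigmaI case_prod_conv image_eqI)
        then show ?thesis using k[OF that(3)] by blast
      qed
      then show ?thesis by blast
    qed
    then obtain m where
      sep: "\<forall>\<alpha>\<in>A. \<forall>\<beta>\<in>A. \<alpha> \<noteq> \<beta> \<longrightarrow> \<alpha> \<inter> {..<m} \<noteq> \<beta> \<inter> {..<m}" ..
    have m: "inj_on (\<lambda>\<alpha>. \<alpha> \<inter> {..<m}) A"
    proof (rule inj_onI)
      fix \<alpha> \<beta> assume "\<alpha> \<in> A" "\<beta> \<in> A" "\<alpha> \<inter> {..<m} = \<beta> \<inter> {..<m}"
      then show "\<alpha> = \<beta>" using sep by metis
    qed
    define e where "e \<alpha> = set_encode (\<alpha> \<inter> {..<m})" for \<alpha>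
    have e: "inj_on e A"
      unfolding e_def using m by (auto simp: inj_on_def set_encode_eq)
    obtain K where K: "\<And>\<alpha>. \<alpha> \<in> A \<Longrightarrow> e \<alpha> < K"
      using fin finite_nat_set_iff_bounded[of "e ` A"] by auto
    obtain H where H: "\<And>\<alpha>. \<alpha> \<in> A \<Longrightarrow> h \<alpha> \<le> H"
      using fin finite_nat_set_iff_bounded_le[of "h ` A"] by auto
    define L where "L = map (\<lambda>c. h (the_inv_into A e c)) [0..<K]"
    have L: "L ! e \<alpha> = h \<alpha>" if "\<alpha> \<in> A" for \<alpha>
      using K[OF that] e that by (simp add: L_def the_inv_into_f_f)
    \<comment> \<open>The component \<open>i\<close> is not read by \<open>f\<close>. Letting it
      vary gives codes of the same table beyond every bound, and past \<open>H\<close> the cap in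
      \<open>f\<close> leaves the prescribed values intact.\<close>
    have "infinite (range (\<lambda>i::nat. to_nat (i, m, L)))"
      by (intro range_inj_infinite) (auto simp: inj_on_def)
    then obtain k where "k \<ge> max N H" "k \<in> range (\<lambda>i::nat. to_nat (i, m, L))"
      unfolding infinite_nat_iff_unbounded_le by blast
    then obtain i :: nat where i: "to_nat (i, m, L) \<ge> max N H" by blast
    have "f \<alpha> (to_nat (i, m, L)) = h \<alpha>" if "\<alpha> \<in> A" for \<alpha>
      using L[OF that] H[OF that] i by (simp add: f_def code_def flip: e_def)
    with i show ?thesis by auto
  qed
  have "f \<alpha> n \<le> n" for \<alpha> n by (simp add: f_def split: prod.split)
  from that[OF this prescribe] show thesis .
qed

section \<open>Derived sets in metrizable spaces\<close>

text \<open>These are the derived sets of the space itself, without the point at infinity; all local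
  constructions take place in them.\<close>

primrec derived_level :: "nat \<Rightarrow> 'a::topological_space set" where
  "derived_level 0 = UNIV"
| "derived_level (Suc n) = {x. x islimpt derived_level n}"

lemma derived_level_Suc_subset: "derived_level (Suc n) \<subseteq> derived_level n"
  by (induction n) (auto elim: islimpt_subset)

lemma derived_level_antimono: "m \<le> n \<Longrightarrow> derived_level n \<subseteq> derived_level m"
  by (rule lift_Suc_antimono_le) (rule derived_level_Suc_subset)

text \<open>The points form a type with a topology only, so a compatible metric is carried along as
  a parameter.\<close>

locale metrized_space = Metric_space UNIV d
  for d :: "'a::topological_space \<Rightarrow> 'a \<Rightarrow> real" +
  assumes mtopology_eq: "mtopology = euclidean"
begin

lemma open_iff: "open U \<longleftrightarrow> (\<forall>x\<in>U. \<exists>r>0. mball x r \<subseteq> U)"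
  using openin_mtopology[of U] by (auto simp: mtopology_eq)

lemma open_mball [simp]: "open (mball x r)"
  using openin_mball[of x r] by (simp add: mtopology_eq)

lemma closed_mcball [simp]: "closed (mcball x r)"
  using closedin_mcball[of x r] by (simp add: mtopology_eq)

lemma islimpt_iff: "x islimpt S \<longleftrightarrow> (\<forall>r>0. \<exists>y\<in>S. y \<noteq> x \<and> d x y < r)"
proof
  assume "x islimpt S"
  then show "\<forall>r>0. \<exists>y\<in>S. y \<noteq> x \<and> d x y < r"
    using open_mball unfolding islimpt_def by (metis UNIV_I centre_in_mball_iff in_mball)
next
  assume *: "\<forall>r>0. \<exists>y\<in>S. y \<noteq> x \<and> d x y < r"
  show "x islimpt S"
  proof (rule islimptI)
    fix U assume "x \<in> U" "open U"
    then obtain r where "r > 0" "mball x r \<subseteq> U" using open_iff by blast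
    then show "\<exists>y\<in>S. y \<in> U \<and> y \<noteq> x" using * by (metis UNIV_I in_mball subsetD)
  qed
qed

lemma closure_iff: "x \<in> closure S \<longleftrightarrow> (\<forall>r>0. \<exists>y\<in>S. d x y < r)"
  unfolding closure_def by (auto simp: islimpt_iff) (metis UNIV_I mdist_zero)

lemma not_islimpt_finite: "finite F \<Longrightarrow> \<not> (x :: 'a) islimpt F"
proof (induction F rule: finite_induct)
  case (insert a F)
  have "\<not> x islimpt {a}"
    by (auto simp: islimpt_iff intro!: exI[of _ "if x = a then 1 else d x a"])
  then show ?case using insert by (metis insert_is_Un islimpt_Un)
qed simp

lemma islimpt_Diff_finite: "finite F \<Longrightarrow> (x :: 'a) islimpt S \<Longrightarrow> x islimpt (S - F)"
  by (metis Un_Diff_cancel2 islimpt_Un not_islimpt_finite)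

lemma closed_finite: "finite F \<Longrightarrow> closed (F :: 'a set)"
  by (simp add: closed_limpt not_islimpt_finite)

lemma closed_derived_level: "closed (derived_level n :: 'a set)"
proof (cases n)
  case (Suc m)
  have "x islimpt derived_level m" if "x islimpt derived_level (Suc m)" for x :: 'a
    using that derived_level_Suc_subset islimpt_subset by blast
  then show ?thesis by (simp add: Suc closed_limpt)
qed simp

section \<open>Distance to a set, and nested layers below a point of a derived set\<close>

text \<open>This plays the role of \<open>infdist\<close> for the metric \<open>d\<close>. The
  infimum over the empty set is unspecified, whence the nonemptiness assumptions below.\<close>

definition inf_distance :: "'a set \<Rightarrow> 'a \<Rightarrow> real" where
  "inf_distance T x = (INF t\<in>T. d x t)"

lemma inf_distance_le: "t \<in> T \<Longrightarrow> inf_distance T x \<le> d x t"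
  unfolding inf_distance_def by (rule cINF_lower) (auto intro!: bdd_belowI[of _ 0])

lemma inf_distance_nonneg: "T \<noteq> {} \<Longrightarrow> 0 \<le> inf_distance T x"
  unfolding inf_distance_def by (rule cINF_greatest) auto

lemma inf_distance_triangle:
  assumes "T \<noteq> {}" shows "inf_distance T x \<le> d x y + inf_distance T y"
proof -
  have "inf_distance T x - d x y \<le> d y t" if "t \<in> T" for t
    using inf_distance_le[OF that, of x] triangle[of x y t] by simp
  then have "inf_distance T x - d x y \<le> inf_distance T y"
    using assms unfolding inf_distance_def[of T y] by (intro cINF_greatest) auto
  then show ?thesis by simp
qed

lemma inf_distance_eq_0:
  assumes "T \<noteq> {}" "closed T" shows "inf_distance T x = 0 \<longleftrightarrow> x \<in> T"
proof
  assume "x \<in> T"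
  then show "inf_distance T x = 0"
    using inf_distance_le[of x T x] inf_distance_nonneg[OF assms(1)] by (simp add: order_antisym)
next
  assume 0: "inf_distance T x = 0"
  show "x \<in> T"
  proof (rule ccontr)
    assume "x \<notin> T"
    then obtain r where r: "r > 0" "mball x r \<subseteq> - T"
      using assms(2) open_iff[of "- T"] by (auto simp: closed_def)
    then have "r \<le> inf_distance T x"
      unfolding inf_distance_def using assms(1) by (intro cINF_greatest) (auto simp: subset_eq not_less)
    then show False using 0 r by simp
  qed
qed


text \<open>\<open>E\<close> is a maximal subset of \<open>X - T\<close> that is separated at the scale of the distance
  to \<open>T\<close>.\<close>

lemma discrete_layer:
  fixes T :: "'a set"
  assumes T: "closed T" "T \<noteq> {}" "T \<subseteq> W" "open W" and lim: "T \<subseteq> closure (X - T)"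
  obtains E where "E \<subseteq> X \<inter> W - T" "closed (T \<union> E)" "T \<subseteq> closure E"
    "\<And>e. e \<in> E \<Longrightarrow> \<not> e islimpt (T \<union> E)"
proof -
  define g where "g = inf_distance T"
  have g0: "g x > 0 \<longleftrightarrow> x \<notin> T" for x
    using inf_distance_eq_0[OF T(2,1), of x] inf_distance_nonneg[OF T(2), of x] by (auto simp: g_def)
  have gtri: "g x \<le> d x y + g y" for x y using inf_distance_triangle T by (simp add: g_def)
  define sep where "sep a b \<longleftrightarrow> g a \<le> 2 * d a b \<and> g b \<le> 2 * d a b" for a b
  define \<F> where "\<F> = {E. E \<subseteq> X \<inter> W - T \<and> (\<forall>a\<in>E. \<forall>b\<in>E. a \<noteq> b \<longrightarrow> sep a b)}"
  have "\<exists>M\<in>\<F>. \<forall>E\<in>\<F>. M \<subseteq> E \<longrightarrow> E = M"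
  proof (rule subset_Zorn_nonempty)
    show "\<F> \<noteq> {}" unfolding \<F>_def by blast
  next
    fix \<C> assume "\<C> \<noteq> {}" and ch: "subset.chain \<F> \<C>"
    have sub: "\<C> \<subseteq> \<F>" using ch by (simp add: subset.chain_def)
    have "sep a b" if "a \<in> \<Union>\<C>" "b \<in> \<Union>\<C>" "a \<noteq> b" for a b
    proof -
      obtain F G where FG: "a \<in> F" "b \<in> G" "F \<in> \<C>" "G \<in> \<C>" using \<open>a \<in> _\<close> \<open>b \<in> _\<close> by blast
      moreover have "F \<subseteq> G \<or> G \<subseteq> F" using ch FG by (auto simp: subset_chain_def)
      ultimately obtain H where "a \<in> H" "b \<in> H" "H \<in> \<F>" using sub by blast
      then show ?thesis using \<open>a \<noteq> b\<close> by (simp add: \<F>_def)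
    qed
    then show "\<Union>\<C> \<in> \<F>" using sub unfolding \<F>_def by blast
  qed
  then obtain E where E: "E \<in> \<F>" and max: "\<And>F. F \<in> \<F> \<Longrightarrow> E \<subseteq> F \<Longrightarrow> F = E" by blast
  have EX: "E \<subseteq> X \<inter> W - T" and sep: "\<And>a b. a \<in> E \<Longrightarrow> b \<in> E \<Longrightarrow> a \<noteq> b \<Longrightarrow> sep a b"
    using E by (auto simp: \<F>_def)
  have iso: "\<not> y islimpt E" if "y \<notin> T" for y
  proof
    assume y: "y islimpt E"
    define c where "c = g y"
    have c: "c > 0" using that g0 by (simp add: c_def)
    \<comment> \<open>Two points of \<open>E\<close> within \<open>c/8\<close> of \<open>y\<close>
      are less than \<open>c/4\<close> apart, while \<open>g\<close> exceeds \<open>7c/8\<close> at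
      both; this contradicts \<open>sep\<close>. Taking \<open>b\<close> closer to \<open>y\<close>
      than \<open>a\<close> makes them distinct.\<close>
    from y c obtain a where a: "a \<in> E" "a \<noteq> y" "d y a < c/8" 
      unfolding islimpt_iff by (metis divide_pos_pos zero_less_numeral)
    have "min (c/8) (d y a) > 0" using a c by simp
    with y obtain b where b: "b \<in> E" "b \<noteq> y" "d y b < min (c/8) (d y a)"
      unfolding islimpt_iff by metis
    have "sep a b" using sep a b by force
    moreover have "d a b \<le> d y a + d y b" using triangle[of a y b] commute by simp
    moreover have "c \<le> d y a + g a" using gtri c_def by simp
    ultimately show False using a b c unfolding sep_def by linarith
  qed
  have "T \<subseteq> closure E"
  proof
    fix t assume t: "t \<in> T"
    show "t \<in> closure E" unfolding closure_iff
    proof (intro allI impI)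
      fix r :: real assume r: "r > 0"
      obtain s where s: "s > 0" "mball t s \<subseteq> W" using T t open_iff by blast
      \<comment> \<open>The bound \<open>s\<close> keeps \<open>x\<close> inside \<open>W\<close>;
        halving \<open>r\<close> leaves room for a second step from \<open>x\<close> to a point of
        \<open>E\<close>.\<close>
      define \<delta> where "\<delta> = min s (r/2)"
      have \<delta>: "\<delta> > 0" using r s by (simp add: \<delta>_def)
      then obtain x where x: "x \<in> X - T" "d t x < \<delta>" using lim t closure_iff by blast
      have gx: "g x \<le> d t x" using inf_distance_le[OF t, of x] by (simp add: g_def commute)
      have xW: "x \<in> W" using s x by (auto simp: \<delta>_def)
      show "\<exists>y\<in>E. d t y < r"
      proof (cases "x \<in> E")
        case True
        then show ?thesis using x \<delta>_def r by (intro bexI[of _ x]) auto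
      next
        case False
        \<comment> \<open>By maximality \<open>x\<close> fails to be separated from some
          \<open>e\<close> in \<open>E\<close>. This gives \<open>d e x < g x \<le> d t x\<close>,
          so \<open>e\<close> is within \<open>2 * d t x\<close> of \<open>t\<close>.\<close>
        then have "insert x E \<notin> \<F>" using max[of "insert x E"] by blast
        then obtain e where e: "e \<in> E" "e \<noteq> x" "\<not> sep e x \<or> \<not> sep x e"
          using EX x xW sep False unfolding \<F>_def by fastforce
        then have "d e x < g x"
          using gtri[of e x] commute[of x e] nonneg[of e x]
            unfolding sep_def by linarith
        then have "d t e < r" using gx x triangle[of t x e] commute[of x e] by (auto simp: \<delta>_def)
        then show ?thesis using e by blast
      qed
    qed
  qed
  moreover have "closed (T \<union> E)"
    using iso T(1) by (auto simp: closed_limpt islimpt_Un)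
  moreover have "\<not> e islimpt (T \<union> E)" if "e \<in> E" for e
    using iso[of e] T(1) that EX by (auto simp: closed_limpt islimpt_Un)
  ultimately show thesis using that EX by blast
qed

text \<open>The sets are built upwards from \<open>{x}\<close>: each step adds a discrete layer,
  taken from the next lower derived set, that accumulates at every point present so far. Each step
  uses up one derived level, so \<open>n\<close> steps are available.\<close>

lemma layers_below_derived_level:
  assumes x: "x \<in> derived_level n" and W: "open W" "x \<in> W"
  obtains S :: "nat \<Rightarrow> 'a set" where "\<And>j. closed (S j)" "\<And>j. S j \<subseteq> W" "antimono S" "x \<in> S n"
    "\<And>j. j < n \<Longrightarrow> S (Suc j) \<subseteq> closure (S j - S (Suc j))"
proof -
  \<comment> \<open>The last clause of \<open>P\<close> is what \<open>discrete_layer\<close> needs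
    for the next step. Once \<open>i\<close> reaches \<open>n\<close> the levels are exhausted, and
    the guards leave only closedness, containment and monotonicity.\<close>
  define P where "P i T \<longleftrightarrow> closed T \<and> T \<subseteq> W \<and> x \<in> T \<and>
    (i < n \<longrightarrow> T \<subseteq> closure (derived_level (n - Suc i) - T))" for i and T :: "'a set"
  define Q where "Q i T T' \<longleftrightarrow> T \<subseteq> T' \<and> (i < n \<longrightarrow> T \<subseteq> closure (T' - T))" for i and T T' :: "'a set"
  have "\<exists>T. \<forall>i. P i (T i) \<and> Q i (T i) (T (Suc i))"
  proof (rule dependent_nat_choice)
    have "x \<in> closure (derived_level (n - 1) - {x})" if "n > 0"
    proof -
      have "x islimpt derived_level (n - 1)" using x that by (cases n) auto
      then have "x islimpt derived_level (n - 1) - {x}" by (simp add: islimpt_Diff_finite)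
      then show ?thesis by (simp add: closure_def)
    qed
    then have "P 0 {x}" using W by (simp add: P_def closed_finite)
    then show "\<exists>T. P 0 T" ..
  next
    fix T i assume P: "P i T"
    show "\<exists>T'. P (Suc i) T' \<and> Q i T T'"
    proof (cases "i < n")
      case False
      then show ?thesis using P by (intro exI[of _ T]) (auto simp: P_def Q_def)
    next
      case True
      obtain E where E: "E \<subseteq> derived_level (n - Suc i) \<inter> W - T" "closed (T \<union> E)" "T \<subseteq> closure E"
        "\<And>e. e \<in> E \<Longrightarrow> \<not> e islimpt (T \<union> E)"
        using discrete_layer[of T W "derived_level (n - Suc i)"] P W True unfolding P_def by blast
      \<comment> \<open>A new point is a limit point of the next lower level and isolated in
        \<open>T \<union> E\<close>, so it is a limit point of that level outside
        \<open>T \<union> E\<close>. The old points follow because they lie in the closure of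
        \<open>E\<close>.\<close>
      have "T \<union> E \<subseteq> closure (derived_level (n - Suc (Suc i)) - (T \<union> E))" if "Suc i < n"
      proof -
        let ?D = "derived_level (n - Suc (Suc i))"
        have "n - Suc i = Suc (n - Suc (Suc i))" using that by simp
        then have "e islimpt ?D" if "e \<in> E" for e using E(1) that by auto
        then have "e islimpt (?D - (T \<union> E)) \<union> (T \<union> E)" if "e \<in> E" for e
          using islimpt_subset[of e ?D "?D - (T \<union> E) \<union> (T \<union> E)"] that by blast
        then have "e islimpt (?D - (T \<union> E))" if "e \<in> E" for e
          using E(4)[OF that] that islimpt_Un by blast
        then have EE: "E \<subseteq> closure (?D - (T \<union> E))" unfolding closure_def by blast
        then have "closure E \<subseteq> closure (?D - (T \<union> E))" by (simp add: closure_minimal)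
        then show ?thesis using EE E(3) by blast
      qed
      then have "P (Suc i) (T \<union> E)" using E P by (auto simp: P_def)
      moreover have "T \<union> E - T = E" using E(1) by blast
      ultimately show ?thesis using E(3) by (intro exI[of _ "T \<union> E"]) (simp add: Q_def)
    qed
  qed
  then obtain T where T: "\<And>i. P i (T i)" "\<And>i. Q i (T i) (T (Suc i))" by blast
  have mono: "mono T" using T(2) by (simp add: mono_iff_le_Suc Q_def)
  show thesis
  \<comment> \<open>Reversing the index makes the increasing sets decrease, with
    \<open>S n = T 0\<close> containing \<open>x\<close>.\<close>
  proof (rule that[of "\<lambda>j. T (n - j)"])
    show "antimono (\<lambda>j. T (n - j))"
      using mono by (intro antimonoI) (simp add: monoD diff_le_mono2)
    fix j assume "j < n"
    then have "n - j = Suc (n - Suc j)" by simp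
    then show "T (n - Suc j) \<subseteq> closure (T (n - j) - T (n - Suc j))"
      using T(2)[of "n - Suc j"] \<open>j < n\<close> by (simp add: Q_def)
  qed (use T(1) in \<open>auto simp: P_def\<close>)
qed

end

section \<open>Derived sets of the one-point compactification\<close>

text \<open>The image of an open \<open>U\<close> under \<open>Some\<close> is open in the
  compactification and misses \<open>None\<close>, so the points that accumulate at
  \<open>Some x\<close> there come from the space itself.\<close>

lemma derived_level_if_limit_points_iter:
  fixes x :: "'a::topological_space"
  assumes "Some x \<in> limit_points_iter n (Alexandroff_compactification euclidean)"
  shows "x \<in> derived_level n"
  using assms
proof (induction n arbitrary: x)
  case (Suc n)
  let ?K = "Alexandroff_compactification (euclidean :: 'a topology)"
  let ?S = "limit_points_iter n ?K"
  have "x islimpt derived_level n"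
  proof (rule islimptI)
    fix U assume U: "x \<in> U" "open U"
    have "openin (subtopology ?K ?S) (Some ` U \<inter> ?S)"
      using U by (simp add: openin_subtopology_Int)
    moreover have "Some x \<in> ?S" using Suc.prems by (simp add: in_derived_set_of)
    moreover have "\<exists>y. y \<noteq> Some x \<and> y \<in> ?S \<and> y \<in> T"
      if "openin (subtopology ?K ?S) T" "Some x \<in> T" for T
      using Suc.prems that by (simp add: in_derived_set_of)
    ultimately obtain y where "y \<noteq> Some x" "y \<in> ?S" "y \<in> Some ` U"
      using U(1) by (metis IntD1 IntI imageI)
    then show "\<exists>y\<in>derived_level n. y \<in> U \<and> y \<noteq> x" using Suc.IH by blast
  qed
  then show ?case by simp
qed simp

text \<open>The complement of \<open>C\<close> together with the point at infinity is a
  neighbourhood of \<open>None\<close>, so it meets the \<open>n\<close>-th derived set in some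
  other point.\<close>

lemma derived_level_escapes_compact:
  fixes C :: "'a::topological_space set"
  assumes None: "None \<in> limit_points_iter (Suc n) (Alexandroff_compactification (euclidean :: 'a topology))"
    and C: "compact C" "closed C"
  shows "\<exists>x\<in>derived_level n. x \<notin> C"
proof -
  let ?K = "Alexandroff_compactification (euclidean :: 'a topology)"
  let ?S = "limit_points_iter n ?K"
  let ?U = "insert None (Some ` (- C))"
  have "openin ?K ?U"
    using C by (auto simp: openin_Alexandroff_compactification Compl_eq_Diff_UNIV)
  then have "openin (subtopology ?K ?S) (?U \<inter> ?S)" by (simp add: openin_subtopology_Int)
  moreover have "None \<in> ?S" using None by (simp add: in_derived_set_of)
  moreover have "\<exists>y. y \<noteq> None \<and> y \<in> ?S \<and> y \<in> T"
    if "openin (subtopology ?K ?S) T" "None \<in> T" for T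
    using None that by (simp add: in_derived_set_of)
  ultimately obtain y where "y \<noteq> None" "y \<in> ?S" "y \<in> ?U"
    by (metis IntD1 IntI insertI1)
  then obtain x where "Some x \<in> ?S" "x \<notin> C" by blast
  then show ?thesis using derived_level_if_limit_points_iter by blast
qed

section \<open>Sequences of points accumulating only at \<open>p\<close>, and balls around
  them\<close>

lemma injective_choice:
  assumes "\<And>n::nat. infinite (A n)"
  obtains x where "inj x" "\<And>n. x n \<in> A n"
proof -
  \<comment> \<open>The state pairs the current point with a finite set containing all points chosen
    so far, which the next choice avoids.\<close>
  define P where "P n s \<longleftrightarrow> finite (snd s) \<and> fst s \<in> snd s \<and> fst s \<in> A n" for n and s :: "'a \<times> 'a set"
  define Q where "Q n s t \<longleftrightarrow> snd s \<subseteq> snd t \<and> fst t \<notin> snd s"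
    for n :: nat and s t :: "'a \<times> 'a set"
  have "\<exists>s. \<forall>n. P n (s n) \<and> Q n (s n) (s (Suc n))"
  proof (rule dependent_nat_choice)
    obtain a where "a \<in> A 0" using assms[of 0] by (metis ex_in_conv finite.emptyI)
    then show "\<exists>s. P 0 s" by (intro exI[of _ "(a, {a})"]) (simp add: P_def)
  next
    fix s n assume P: "P n s"
    then obtain a where "a \<in> A (Suc n)" "a \<notin> snd s"
      using assms[of "Suc n"] by (meson P_def finite_subset subsetI)
    then show "\<exists>t. P (Suc n) t \<and> Q n s t"
      using P by (intro exI[of _ "(a, insert a (snd s))"]) (auto simp: P_def Q_def)
  qed
  then obtain s where s: "\<And>n. P n (s n)" "\<And>n. Q n (s n) (s (Suc n))" by blast
  have mono: "mono (snd \<circ> s)" using s(2) by (simp add: mono_iff_le_Suc Q_def)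
  have neq: "fst (s m) \<noteq> fst (s n)" if "m < n" for m n
  proof -
    have n: "Suc (n - 1) = n" "m \<le> n - 1" using that by simp_all
    have "snd (s m) \<subseteq> snd (s (n - 1))" using monoD[OF mono n(2)] by simp
    then have "fst (s m) \<in> snd (s (n - 1))" using s(1)[of m] by (auto simp: P_def)
    then show ?thesis using s(2)[of "n - 1"] n(1) by (auto simp: Q_def)
  qed
  have "inj (\<lambda>n. fst (s n))" by (rule injI) (metis neq linorder_neqE_nat)
  with s(1) show thesis using that by (auto simp: P_def)
qed

locale locally_compact_metrized_space = metrized_space +
  assumes ex_compact_mcball: "\<exists>c>0. compact (mcball y c)"
begin

lemma compact_neighbourhood:
  fixes L :: "'a set"
  assumes "compact L"
  obtains V K where "open V" "L \<subseteq> V" "V \<subseteq> K" "compact K" "closed K"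
proof -
  obtain c where c: "\<And>y. c y > 0" "\<And>y. compact (mcball y (c y))" using ex_compact_mcball by metis
  have "L \<subseteq> (\<Union>y\<in>L. mball y (c y))" using c(1) by auto
  then obtain F where F: "F \<subseteq> L" "finite F" "L \<subseteq> (\<Union>y\<in>F. mball y (c y))"
    by (rule compactE_image[OF assms open_mball])
  show thesis
  proof
    show "L \<subseteq> (\<Union>y\<in>F. mball y (c y))" by fact
    show "(\<Union>y\<in>F. mball y (c y)) \<subseteq> (\<Union>y\<in>F. mcball y (c y))"
      using mball_subset_mcball by blast
  qed (use F c in \<open>auto intro!: compact_UN\<close>)
qed

lemma sequence_tending_to_point:
  assumes "\<And>n. q \<in> derived_level n"
  obtains x where "inj x" "\<And>n. x n \<in> derived_level n" "\<And>n. x n \<noteq> q" "\<And>n. d q (x n) < 1 / Suc n"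
    "\<And>y. y \<noteq> q \<Longrightarrow> \<exists>c>0. finite {n. d y (x n) < c}"
proof -
  define A where "A n = {x \<in> derived_level n. x \<noteq> q \<and> d q x < 1 / Suc n}" for n
  have inf: "infinite (A n)" for n
  proof
    assume "finite (A n)"
    moreover have "q islimpt derived_level n" using assms[of "Suc n"] by simp
    ultimately have "q islimpt derived_level n - A n" by (simp add: islimpt_Diff_finite)
    then obtain y where "y \<in> derived_level n - A n" "y \<noteq> q" "d q y < 1 / Suc n"
      unfolding islimpt_iff by (metis of_nat_0_less_iff zero_less_Suc zero_less_divide_1_iff)
    then show False by (simp add: A_def)
  qed
  obtain x where x: "inj x" "\<And>n. x n \<in> A n" using injective_choice[of A] inf by blast
  have "\<exists>c>0. finite {n. d y (x n) < c}" if "y \<noteq> q" for y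
  proof -
    \<comment> \<open>From \<open>N\<close> on the points are closer to \<open>q\<close> than half
      the distance from \<open>y\<close> to \<open>q\<close>, so they stay at distance at least
      \<open>c\<close> from \<open>y\<close>.\<close>
    define c where "c = d y q / 2"
    have c: "c > 0" using that by (simp add: c_def)
    then obtain N where N: "1 / Suc N < c" using nat_approx_posE by blast
    have "n < N" if "d y (x n) < c" for n
    proof (rule ccontr)
      assume "\<not> n < N"
      then have "1 / real (Suc n) \<le> 1 / Suc N" by (simp add: frac_le)
      moreover have "d y q \<le> d y (x n) + d q (x n)" using triangle[of y "x n" q] commute by simp
      ultimately show False using x(2)[of n] N that by (simp add: A_def c_def)
    qed
    then have "{n. d y (x n) < c} \<subseteq> {..<N}" by blast
    then show ?thesis using c finite_subset by blast
  qed
  with x that show thesis by (auto simp: A_def)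
qed

text \<open>Let \<open>L\<close> be the intersection of all derived sets. If \<open>L\<close> is
  compact, the points are taken outside a compact neighbourhood \<open>K\<close> of it: no
  \<open>x n\<close> comes near \<open>L\<close>, and any other point lies outside some closed
  derived set, which contains all later \<open>x n\<close>. If \<open>L\<close> is not compact,
  Bolzano-Weierstrass gives an infinite subset of \<open>L\<close> without limit points in
  \<open>L\<close>, and its points belong to every level.\<close>

lemma sequence_tending_to_infinity:
  assumes "\<And>n (C :: 'a set). compact C \<Longrightarrow> closed C \<Longrightarrow> \<exists>x\<in>derived_level n. x \<notin> C"
  obtains x where "inj x" "\<And>n. x n \<in> derived_level n" "\<And>y. \<exists>c>0. finite {n. d y (x n) < c}"
proof -
  define L :: "'a set" where "L = (\<Inter>n. derived_level n)"
  have closed_L: "closed L" unfolding L_def using closed_derived_level by blast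
  show thesis
  proof (cases "compact L")
    case True
    then obtain V K where VK: "open V" "L \<subseteq> V" "V \<subseteq> K" "compact K" "closed K"
      by (rule compact_neighbourhood)
    have "infinite (derived_level n - K)" for n
    proof
      assume fin: "finite (derived_level n - K)"
      have "compact (derived_level n - K \<union> K)"
        by (rule compact_Un[OF finite_imp_compact[OF fin] VK(4)])
      moreover have "closed (derived_level n - K \<union> K)"
        by (rule closed_Un[OF closed_finite[OF fin] VK(5)])
      ultimately obtain y where "y \<in> derived_level n" "y \<notin> derived_level n - K \<union> K"
        using assms[of "derived_level n - K \<union> K" n] by auto
      then show False by simp
    qed
    then obtain x where x: "inj x" "\<And>n. x n \<in> derived_level n - K"
      using injective_choice[of "\<lambda>n. derived_level n - K"] by blast
    have "\<exists>c>0. finite {n. d y (x n) < c}" for y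
    proof (cases "y \<in> V")
      case True
      then obtain c where "c > 0" "mball y c \<subseteq> V" using VK(1) open_iff by blast
      then have "\<not> d y (x n) < c" for n using x(2)[of n] VK(3) by (auto simp: subset_eq)
      then have "{n. d y (x n) < c} = {}" by blast
      then show ?thesis using \<open>c > 0\<close> by (metis finite.emptyI)
    next
      case False
      then obtain m where "y \<in> - derived_level m" using VK(2) by (auto simp: L_def)
      then obtain c where c: "c > 0" "mball y c \<subseteq> - derived_level m"
        using closed_derived_level[of m] unfolding closed_def open_iff by blast
      have "n < m" if "d y (x n) < c" for n
        using that c x(2)[of n] derived_level_antimono[of m n] by (cases "n < m") auto
      then have "{n. d y (x n) < c} \<subseteq> {..<m}" by blast
      then show ?thesis using c finite_subset by blast
    qed
    with x that show thesis by blast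
  next
    case False
    then have "\<not> compactin mtopology L" by (simp add: mtopology_eq)
    then obtain T where T: "T \<subseteq> L" "infinite T" "L \<inter> mtopology derived_set_of T = {}"
      unfolding compactin_eq_Bolzano_Weierstrass by auto
    obtain x :: "nat \<Rightarrow> 'a" where x: "inj x" "range x \<subseteq> T"
      using T(2) infinite_countable_subset by blast
    have "\<exists>c>0. finite {n. d y (x n) < c}" for y
    proof (cases "y \<in> L")
      case True
      then have "y \<notin> euclidean derived_set_of T" using T(3) by (auto simp: mtopology_eq)
      then have "\<not> y islimpt T" unfolding islimpt_def in_derived_set_of by auto
      then obtain c where c: "c > 0" "\<And>z. z \<in> T \<Longrightarrow> d y z < c \<Longrightarrow> z = y"
        unfolding islimpt_iff by blast
      then have "x n = y" if "d y (x n) < c" for n using x(2) that by blast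
      then have "{n. d y (x n) < c} \<subseteq> x -` {y}" by blast
      then show ?thesis using c(1) x(1) by (meson finite.emptyI finite.insertI finite_subset finite_vimageI)
    next
      case False
      then obtain c where "c > 0" "mball y c \<subseteq> - L" using closed_L open_iff[of "- L"] by auto
      then have "x n \<notin> mball y c" for n using x(2) T(1) by blast
      then have "{n. d y (x n) < c} = {}" by simp
      then show ?thesis using \<open>c > 0\<close> by (metis finite.emptyI)
    qed
    moreover have "x n \<in> derived_level n" for n using x(2) T(1) by (auto simp: L_def)
    ultimately show thesis using that x(1) by blast
  qed
qed

end

text \<open>Both kinds of support are treated at once: for \<open>p = None\<close> the assumptions
  about \<open>Some q\<close> are vacuous and local finiteness holds at every point.\<close>

locale ball_sequence = locally_compact_metrized_space +
  fixes p :: "'a option" and x :: "nat \<Rightarrow> 'a" and r :: "nat \<Rightarrow> real"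
  assumes x_level: "x n \<in> derived_level n"
    and r_pos: "0 < r n"
    and r_le_1: "r n \<le> 1"
    and compact_mcball: "compact (mcball (x n) (r n))"
    and disjoint_balls: "m \<noteq> n \<Longrightarrow> mball (x m) (r m) \<inter> mball (x n) (r n) = {}"
    and point_not_in_ball: "p = Some q \<Longrightarrow> q \<notin> mball (x n) (r n)"
    and balls_tend_to_point: "p = Some q \<Longrightarrow> open U \<Longrightarrow> q \<in> U \<Longrightarrow> \<exists>N. \<forall>n\<ge>N. mball (x n) (r n) \<subseteq> U"
    and balls_locally_finite: "p \<noteq> Some y \<Longrightarrow> \<exists>c>0. finite {n. mball (x n) (r n) \<inter> mball y c \<noteq> {}}"

lemma (in locally_compact_metrized_space) ex_ball_sequence:
  assumes p: "p \<in> limit_points_inf (Alexandroff_compactification (euclidean :: 'a topology))"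
  obtains x r where "ball_sequence d p x r"
proof -
  have p': "p \<in> limit_points_iter (Suc n) (Alexandroff_compactification euclidean)" for n
    using p by (simp add: limit_points_inf_def del: limit_points_iter.simps)
  obtain x where x: "inj x" "\<And>n. x n \<in> derived_level n" "\<And>n. p \<noteq> Some (x n)"
    "\<And>q n. p = Some q \<Longrightarrow> d q (x n) < 1 / Suc n"
    "\<And>y. p \<noteq> Some y \<Longrightarrow> \<exists>c>0. finite {n. d y (x n) < c}"
  proof (cases p)
    case None
    then have escape: "\<exists>x\<in>derived_level n. x \<notin> C" if "compact C" "closed C" for n and C :: "'a set"
      using derived_level_escapes_compact[of n C] p'[of n] that by simp
    show thesis by (rule sequence_tending_to_infinity[OF escape]) (auto simp: None intro: that)
  next
    case (Some q)
    have lev: "q \<in> derived_level n" for n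
      using p'[of n] derived_level_if_limit_points_iter[of q "Suc n"] derived_level_Suc_subset[of n]
      by (auto simp: Some simp del: limit_points_iter.simps derived_level.simps)
    show thesis
    proof (rule sequence_tending_to_point[OF lev])
      fix x assume "inj x" "\<And>n. x n \<in> derived_level n" "\<And>n. x n \<noteq> q"
        "\<And>n. d q (x n) < 1 / real (Suc n)" "\<And>y. y \<noteq> q \<Longrightarrow> \<exists>c>0. finite {n. d y (x n) < c}"
      then show thesis by (intro that[of x]) (simp_all add: Some eq_commute[of q])
    qed
  qed
  have "\<exists>s>0. \<forall>m. m \<noteq> n \<longrightarrow> 2 * s \<le> d (x n) (x m)" for n
  proof -
    obtain c where c: "c > 0" "finite {m. d (x n) (x m) < c}" using x(3,5) by blast
    \<comment> \<open>Only finitely many of the points lie within \<open>c\<close> of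
      \<open>x n\<close>; the element \<open>c\<close> of \<open>M\<close> accounts for all the
      others and keeps \<open>M\<close> nonempty.\<close>
    define M where "M = insert c ((\<lambda>m. d (x n) (x m)) ` ({m. d (x n) (x m) < c} - {n}))"
    have M: "finite M" using c by (simp add: M_def)
    have "0 < Min M" using M c x(1) by (auto simp: M_def inj_def)
    moreover have "Min M \<le> d (x n) (x m)" if "m \<noteq> n" for m
    proof (cases "d (x n) (x m) < c")
      case True
      then show ?thesis using M that by (intro Min_le) (auto simp: M_def)
    next
      case False
      moreover have "Min M \<le> c" using M by (intro Min_le) (simp_all add: M_def)
      ultimately show ?thesis by simp
    qed
    ultimately show ?thesis by (intro exI[of _ "Min M / 2"]) auto
  qed
  then obtain s where s: "\<And>n. s n > 0" "\<And>m n. m \<noteq> n \<Longrightarrow> 2 * s n \<le> d (x n) (x m)" by metis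
  have "\<forall>n. \<exists>c>0. compact (mcball (x n) c)" using ex_compact_mcball by blast
  then obtain c where c: "\<And>n. c n > 0" "\<And>n. compact (mcball (x n) (c n))" by metis
  \<comment> \<open>With no point to avoid, 1 serves as a positive default.\<close>
  define e where "e n = (case p of None \<Rightarrow> 1 | Some q \<Rightarrow> d q (x n))" for n
  have e: "e n > 0" for n using x(3)[of n] by (auto simp: e_def split: option.split)
  \<comment> \<open>The four bounds make the balls disjoint, give them compact closed versions, keep
    \<open>p\<close> out of them and let the radii tend to 0.\<close>
  define r where "r n = min (min (s n) (c n)) (min (e n) (1 / Suc n))" for n
  have r: "0 < r n" "r n \<le> s n" "r n \<le> c n" "r n \<le> e n" "r n \<le> 1 / Suc n" for n
    using s(1)[of n] c(1)[of n] e[of n] by (auto simp: r_def)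
  have small: "\<exists>N. \<forall>n\<ge>N. r n < \<epsilon> \<and> 1 / Suc n < \<epsilon>" if "\<epsilon> > 0" for \<epsilon>
  proof -
    obtain N where N: "1 / Suc N < \<epsilon>" using \<open>\<epsilon> > 0\<close> nat_approx_posE by blast
    have "1 / real (Suc n) \<le> 1 / Suc N" if "n \<ge> N" for n using that by (simp add: frac_le)
    then show ?thesis using N r(5) by (meson le_less_trans)
  qed
  have "ball_sequence d p x r"
  proof (unfold_locales, goal_cases)
    case (3 n)
    have "1 / real (Suc n) \<le> 1" by simp
    then show ?case using r(5)[of n] by linarith
  next
    case (4 n)
    have "mcball (x n) (r n) = mcball (x n) (c n) \<inter> mcball (x n) (r n)" using r(3)[of n] by auto
    then show ?case using compact_Int_closed[OF c(2) closed_mcball] by metis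
  next
    case (5 m n)
    then have "r m + r n \<le> d (x m) (x n)"
      using s(2)[of m n] s(2)[of n m] r(2)[of m] r(2)[of n] commute[of "x m"] by simp
    then show ?case using disjoint_mball by (simp add: disjnt_def)
  next
    case (6 q n)
    then show ?case using r(4)[of n] commute[of q] by (simp add: e_def)
  next
    case (7 q U)
    then obtain \<epsilon> where \<epsilon>: "\<epsilon> > 0" "mball q \<epsilon> \<subseteq> U" using open_iff by blast
    obtain N where N: "\<And>n. n \<ge> N \<Longrightarrow> r n < \<epsilon>/2 \<and> 1 / Suc n < \<epsilon>/2" using small[of "\<epsilon>/2"] \<epsilon> by auto
    have "mball (x n) (r n) \<subseteq> mball q \<epsilon>" if "n \<ge> N" for n
      using N[OF that] x(4)[OF 7(1), of n] by (intro mball_subset) (auto simp: commute[of q])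
    then show ?case using \<epsilon> by blast
  next
    case (8 y)
    then obtain c where c: "c > 0" "finite {n. d y (x n) < c}" using x(5) by blast
    obtain N where N: "\<And>n. n \<ge> N \<Longrightarrow> r n < c/2" using small[of "c/2"] c by auto
    \<comment> \<open>Once \<open>r n < c/2\<close>, a ball meeting \<open>mball y (c/2)\<close> has
      its centre within \<open>c\<close> of \<open>y\<close>, which happens for finitely many
      \<open>n\<close> only.\<close>
    have "n \<in> {n. d y (x n) < c} \<union> {..<N}" if ne: "mball (x n) (r n) \<inter> mball y (c/2) \<noteq> {}" for n
    proof -
      obtain z where "d (x n) z < r n" "d y z < c/2" using ne by auto
      then have "d y (x n) < c" if "n \<ge> N"
        using N[OF that] triangle[of y z "x n"] commute[of z] by simp
      then show ?thesis by (cases "n \<ge> N") auto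
    qed
    then have "{n. mball (x n) (r n) \<inter> mball y (c/2) \<noteq> {}} \<subseteq> {n. d y (x n) < c} \<union> {..<N}" by blast
    then have "finite {n. mball (x n) (r n) \<inter> mball y (c/2) \<noteq> {}}"
      using c(2) by (meson finite_Un finite_lessThan finite_subset)
    then show ?case using c(1) by (intro exI[of _ "c/2"]) simp
  qed (use x r in auto)
  then show thesis using that by blast
qed

section \<open>The ultrafilters\<close>

text \<open>Starting from the smallest of the closed sets, each next point is chosen so close to its
  predecessor that it avoids the members of \<open>\<C>\<close> that the predecessor avoids.\<close>

lemma descending_points:
  fixes S :: "nat \<Rightarrow> 'a::topological_space set"
  assumes dense: "\<And>i. i < j \<Longrightarrow> S (Suc i) \<subseteq> closure (S i - S (Suc i))"
    and \<C>: "finite \<C>" "\<And>C. C \<in> \<C> \<Longrightarrow> closed C" and t: "t \<in> S j"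
  shows "\<exists>z. z j = t \<and> (\<forall>i\<le>j. z i \<in> S i) \<and> (\<forall>i<j. z i \<notin> S (Suc i)) \<and>
    (\<forall>i<j. \<forall>C\<in>\<C>. z i \<in> C \<longrightarrow> z (Suc i) \<in> C)"
  using dense t
proof (induction j arbitrary: t)
  case 0
  then show ?case by (intro exI[of _ "\<lambda>_. t"]) auto
next
  case (Suc j)
  define U where "U = - \<Union>{C\<in>\<C>. t \<notin> C}"
  have "open U" unfolding U_def using \<C> by (intro open_Compl closed_Union) auto
  moreover have "t \<in> U" by (auto simp: U_def)
  moreover have "t \<in> closure (S j - S (Suc j))" using Suc.prems by blast
  ultimately obtain s where s: "s \<in> U" "s \<in> S j - S (Suc j)"
    by (metis IntE closure_iff_nhds_not_empty ex_in_conv subset_refl)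
  have "\<exists>z. z j = s \<and> (\<forall>i\<le>j. z i \<in> S i) \<and> (\<forall>i<j. z i \<notin> S (Suc i)) \<and>
    (\<forall>i<j. \<forall>C\<in>\<C>. z i \<in> C \<longrightarrow> z (Suc i) \<in> C)"
    using s by (intro Suc.IH Suc.prems) auto
  then obtain z where "z j = s \<and> (\<forall>i\<le>j. z i \<in> S i) \<and> (\<forall>i<j. z i \<notin> S (Suc i)) \<and>
    (\<forall>i<j. \<forall>C\<in>\<C>. z i \<in> C \<longrightarrow> z (Suc i) \<in> C)" ..
  then have z: "z j = s" "\<forall>i\<le>j. z i \<in> S i" "\<forall>i<j. z i \<notin> S (Suc i)"
    "\<forall>i<j. \<forall>C\<in>\<C>. z i \<in> C \<longrightarrow> z (Suc i) \<in> C" by simp_all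
  have "t \<in> C" if "C \<in> \<C>" "s \<in> C" for C using that s by (auto simp: U_def)
  then have step: "(z(Suc j := t)) (Suc i) \<in> C" if "i < Suc j" "C \<in> \<C>" "(z(Suc j := t)) i \<in> C" for i C
    using that z(1,4) by (cases "i = j") auto
  have "(z(Suc j := t)) i \<in> S i" if "i \<le> Suc j" for i
    using that z(2) Suc.prems(2) by (cases "i = Suc j") auto
  moreover have "(z(Suc j := t)) i \<notin> S (Suc i)" if "i < Suc j" for i
    using that z(1,3) s by (cases "i = j") auto
  ultimately show ?case
    using step by (intro exI[of _ "z(Suc j := t)"] conjI allI impI ballI) simp_all
qed

context ball_sequence
begin

abbreviation B :: "nat \<Rightarrow> 'a set" where "B n \<equiv> mball (x n) (r n)"

text \<open>Away from \<open>p\<close> the balls are locally finite, so the union of the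
  \<open>K n\<close> can accumulate only at \<open>p\<close>. The set \<open>set_option p\<close>
  adds this point if it belongs to the space and is empty otherwise.\<close>

lemma closed_UN_in_balls:
  assumes "\<And>n. closed (K n)" "\<And>n. K n \<subseteq> B n"
  shows "closed ((\<Union>n. K n) \<union> set_option p)"
proof -
  have "\<exists>U. open U \<and> y \<in> U \<and> U \<subseteq> - ((\<Union>n. K n) \<union> set_option p)"
    if y: "y \<notin> (\<Union>n. K n)" "y \<notin> set_option p" for y
  proof -
    have "p \<noteq> Some y" using y by auto
    then obtain c where c: "c > 0" "finite {n. B n \<inter> mball y c \<noteq> {}}"
      using balls_locally_finite by blast
    define U where "U = mball y c - (\<Union>n\<in>{n. B n \<inter> mball y c \<noteq> {}}. K n) - set_option p"
    have "finite (set_option p)" by (cases p) auto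
    then have "open U" unfolding U_def using c assms(1) closed_finite
      by (intro open_Diff closed_UN) auto
    moreover have "y \<in> U" using y c by (auto simp: U_def)
    moreover have "U \<subseteq> - ((\<Union>n. K n) \<union> set_option p)"
      using assms(2) unfolding U_def by blast
    ultimately show ?thesis by blast
  qed
  then show ?thesis unfolding closed_def by (subst open_subopen) blast
qed

lemma disjoint_ball_point: "B n \<inter> set_option p = {}"
  using point_not_in_ball[of _ n] by (cases p) auto

lemma ex_ultrafilters:
  fixes lt :: "nat set \<Rightarrow> nat set \<Rightarrow> bool"
  assumes irrefl: "\<And>\<alpha>. \<not> lt \<alpha> \<alpha>" and trans: "\<And>\<alpha> \<beta> \<gamma>. lt \<alpha> \<beta> \<Longrightarrow> lt \<beta> \<gamma> \<Longrightarrow> lt \<alpha> \<gamma>"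
  obtains W :: "nat set \<Rightarrow> 'a set set" and Z :: "nat set \<Rightarrow> 'a set"
  where "\<And>\<alpha>. {} \<notin> W \<alpha>"
    "\<And>\<alpha> X Y. X \<in> W \<alpha> \<Longrightarrow> Y \<in> W \<alpha> \<Longrightarrow> X \<inter> Y \<in> W \<alpha>"
    "\<And>\<alpha> X Y. X \<in> W \<alpha> \<Longrightarrow> X \<subseteq> Y \<Longrightarrow> Y \<in> W \<alpha>"
    "\<And>\<alpha> X. X \<in> W \<alpha> \<or> - X \<in> W \<alpha>"
    "\<And>\<alpha> \<beta> C. lt \<alpha> \<beta> \<Longrightarrow> closed C \<Longrightarrow> C \<in> W \<alpha> \<Longrightarrow> C \<in> W \<beta>"
    "\<And>\<alpha>. closed (Z \<alpha>)" "\<And>\<alpha>. Z \<alpha> \<in> W \<alpha>" "\<And>\<alpha> \<beta>. lt \<alpha> \<beta> \<Longrightarrow> Z \<beta> \<notin> W \<alpha>"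
    "\<And>\<alpha> N. (\<Union>n\<in>{N..}. B n) \<in> W \<alpha>"
proof -
  obtain f :: "nat set \<Rightarrow> nat \<Rightarrow> nat" where f: "\<And>\<alpha> n. f \<alpha> n \<le> n"
    "\<And>A h N. finite A \<Longrightarrow> \<exists>n\<ge>N. \<forall>\<alpha>\<in>A. f \<alpha> n = h \<alpha>"
    using independent_functions by blast
  have "\<exists>S. (\<forall>j. closed (S j)) \<and> (\<forall>j. S j \<subseteq> B n) \<and> antimono S \<and> x n \<in> S n \<and>
      (\<forall>j<n. S (Suc j) \<subseteq> closure (S j - S (Suc j)))" for n
  proof -
    have "x n \<in> B n" using r_pos by simp
    from layers_below_derived_level[OF x_level open_mball this] show ?thesis by metis
  qed
  then obtain S where S: "\<And>n j. closed (S n j)" "\<And>n j. S n j \<subseteq> B n" "\<And>n. antimono (S n)"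
    "\<And>n. x n \<in> S n n" "\<And>n j. j < n \<Longrightarrow> S n (Suc j) \<subseteq> closure (S n j - S n (Suc j))"
    by metis
  define Z where "Z \<alpha> = (\<Union>n. S n (f \<alpha> n)) \<union> set_option p" for \<alpha>
  have closed_Z: "closed (Z \<alpha>)" for \<alpha>
    unfolding Z_def using S(1,2) by (intro closed_UN_in_balls)
  \<comment> \<open>The balls are disjoint and avoid \<open>p\<close>, so inside \<open>B n\<close>
    only the \<open>n\<close>-th piece of \<open>Z \<alpha>\<close> is visible.\<close>
  have Z_B: "Z \<alpha> \<inter> B n \<subseteq> S n (f \<alpha> n)" for \<alpha> n
  proof
    fix y assume y: "y \<in> Z \<alpha> \<inter> B n"
    then obtain m where m: "y \<in> S m (f \<alpha> m)" using disjoint_ball_point[of n] by (auto simp: Z_def)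
    then have "m = n" using y S(2)[of m] disjoint_balls[of m n] by blast
    then show "y \<in> S n (f \<alpha> n)" using m by simp
  qed
  \<comment> \<open>These are the finite approximations to the requirements on \<open>y\<close>:
    finitely many indices, finitely many closed sets and one bound on how late the balls must be.
    Membership in late balls later forces the support at \<open>p\<close>.\<close>
  define G where "G A \<C> N = {y. \<forall>\<alpha>\<in>A. y \<alpha> \<in> Z \<alpha> \<and> y \<alpha> \<in> (\<Union>n\<in>{N..}. B n) \<and>
    (\<forall>\<beta>\<in>A. lt \<alpha> \<beta> \<longrightarrow> y \<alpha> \<notin> Z \<beta> \<and> (\<forall>C\<in>\<C>. y \<alpha> \<in> C \<longrightarrow> y \<beta> \<in> C))}" for A \<C> N
  have G_antimono: "G A' \<C>' N' \<subseteq> G A \<C> N" if "A \<subseteq> A'" "\<C> \<subseteq> \<C>'" "N \<le> N'" for A A' \<C> \<C>' N N'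
  proof -
    have "(\<Union>n\<in>{N'..}. B n) \<subseteq> (\<Union>n\<in>{N..}. B n)" using that(3) by (intro UN_mono) auto
    then show ?thesis using that(1,2) unfolding G_def by (intro Collect_mono impI) (meson subsetD)
  qed
  have G_nonempty: "G A \<C> N \<noteq> {}" if fin: "finite A" "finite \<C>" and cl: "\<forall>C\<in>\<C>. closed C" for A \<C> N
  proof -
    \<comment> \<open>The rank within \<open>A\<close> translates \<open>lt\<close> into the order
      of the naturals. It is at most \<open>card A\<close>, so in a ball with
      \<open>n \<ge> card A\<close> every rank is a valid layer index.\<close>
    define h where "h \<alpha> = card {\<gamma>\<in>A. lt \<gamma> \<alpha>}" for \<alpha>
    have h_mono: "h \<alpha> < h \<beta>" if "\<alpha> \<in> A" "\<beta> \<in> A" "lt \<alpha> \<beta>" for \<alpha> \<beta>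
    proof -
      have "{\<gamma>\<in>A. lt \<gamma> \<alpha>} \<subseteq> {\<gamma>\<in>A. lt \<gamma> \<beta>}" using trans that(3) by blast
      moreover have "\<alpha> \<in> {\<gamma>\<in>A. lt \<gamma> \<beta>} - {\<gamma>\<in>A. lt \<gamma> \<alpha>}" using that irrefl by simp
      ultimately have "{\<gamma>\<in>A. lt \<gamma> \<alpha>} \<subset> {\<gamma>\<in>A. lt \<gamma> \<beta>}" by blast
      then show ?thesis unfolding h_def using fin by (intro psubset_card_mono) simp_all
    qed
    have h_le: "h \<alpha> \<le> card A" for \<alpha> unfolding h_def using fin by (intro card_mono) auto
    obtain n where n: "n \<ge> max N (card A)" "\<And>\<alpha>. \<alpha> \<in> A \<Longrightarrow> f \<alpha> n = h \<alpha>"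
      using f(2)[OF fin(1)] by blast
    have h_n: "h \<alpha> \<le> n" for \<alpha> using h_le[of \<alpha>] n(1) by linarith
    have "\<exists>z. z n = x n \<and> (\<forall>i\<le>n. z i \<in> S n i) \<and> (\<forall>i<n. z i \<notin> S n (Suc i)) \<and>
      (\<forall>i<n. \<forall>C\<in>\<C>. z i \<in> C \<longrightarrow> z (Suc i) \<in> C)"
      using S(4,5) fin cl by (intro descending_points) auto
    then obtain z where "z n = x n \<and> (\<forall>i\<le>n. z i \<in> S n i) \<and> (\<forall>i<n. z i \<notin> S n (Suc i)) \<and>
      (\<forall>i<n. \<forall>C\<in>\<C>. z i \<in> C \<longrightarrow> z (Suc i) \<in> C)" ..
    then have z: "i \<le> n \<Longrightarrow> z i \<in> S n i" "i < n \<Longrightarrow> z i \<notin> S n (Suc i)"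
      "i < n \<Longrightarrow> C \<in> \<C> \<Longrightarrow> z i \<in> C \<Longrightarrow> z (Suc i) \<in> C" for i C by simp_all
    have z_up: "z j \<in> C" if "i \<le> j" "j \<le> n" "C \<in> \<C>" "z i \<in> C" for i j C
      using that by (induction j rule: dec_induct) (auto simp: z(3))
    have z_notin: "z i \<notin> S n j" if "i < j" "j \<le> n" for i j
      using z(2)[of i] antimonoD[OF S(3)[of n], of "Suc i" j] that by auto
    have zB: "z (h \<alpha>) \<in> B n" for \<alpha> using z(1)[OF h_n] S(2) by blast
    \<comment> \<open>One descent in one ball serves all indices: the point for
      \<open>\<alpha>\<close> lies in layer \<open>h \<alpha>\<close> but in none of the layers
      belonging to larger indices, and membership in the sets of \<open>\<C>\<close> passes from
      smaller to larger ranks.\<close>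
    have "(\<lambda>\<alpha>. z (h \<alpha>)) \<in> G A \<C> N"
      unfolding G_def mem_Collect_eq
    proof (intro ballI conjI impI)
      fix \<alpha> assume \<alpha>: "\<alpha> \<in> A"
      have "z (h \<alpha>) \<in> S n (f \<alpha> n)" using z(1)[OF h_n[of \<alpha>]] n(2)[OF \<alpha>] by simp
      then show "z (h \<alpha>) \<in> Z \<alpha>" unfolding Z_def by blast
      show "z (h \<alpha>) \<in> (\<Union>n\<in>{N..}. B n)" using zB[of \<alpha>] n(1) by (intro UN_I[of n]) auto
      fix \<beta> assume \<beta>: "\<beta> \<in> A" "lt \<alpha> \<beta>"
      then have lt: "h \<alpha> < h \<beta>" using h_mono \<alpha> by blast
      have "z (h \<alpha>) \<notin> S n (f \<beta> n)" using z_notin[OF lt h_n] n(2)[OF \<beta>(1)] by simp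
      then show "z (h \<alpha>) \<notin> Z \<beta>" using Z_B[of \<beta> n] zB[of \<alpha>] by blast
      fix C assume "C \<in> \<C>" "z (h \<alpha>) \<in> C"
      then show "z (h \<beta>) \<in> C" using z_up[of "h \<alpha>" "h \<beta>"] lt h_n by simp
    qed
    then show ?thesis by blast
  qed
  define \<B> where "\<B> = {G A \<C> N |A \<C> N. finite A \<and> finite \<C> \<and> (\<forall>C\<in>\<C>. closed C)}"
  have directed: "\<exists>Y\<in>\<B>. Y \<subseteq> X1 \<inter> X2" if X: "X1 \<in> \<B>" "X2 \<in> \<B>" for X1 X2
  proof -
    obtain A1 \<C>1 N1 A2 \<C>2 N2 where eq: "X1 = G A1 \<C>1 N1" "X2 = G A2 \<C>2 N2"
      and fin: "finite A1" "finite \<C>1" "\<forall>C\<in>\<C>1. closed C" "finite A2" "finite \<C>2" "\<forall>C\<in>\<C>2. closed C"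
      using X unfolding \<B>_def by blast
    have "G (A1 \<union> A2) (\<C>1 \<union> \<C>2) (max N1 N2) \<in> \<B>" unfolding \<B>_def using fin by blast
    moreover have "G (A1 \<union> A2) (\<C>1 \<union> \<C>2) (max N1 N2) \<subseteq> X1 \<inter> X2"
      unfolding eq by (intro Int_greatest G_antimono) auto
    ultimately show ?thesis by blast
  qed
  have "\<B> \<noteq> {}" "{} \<notin> \<B>" unfolding \<B>_def using G_nonempty by blast+
  then show thesis
  proof (rule ultrafilter_extending_base[OF _ _ directed])
    fix \<U>
    assume \<U>: "\<B> \<subseteq> \<U>" "{} \<notin> \<U>" "\<And>A B. A \<in> \<U> \<Longrightarrow> B \<in> \<U> \<Longrightarrow> A \<inter> B \<in> \<U>"
      "\<And>A B. A \<in> \<U> \<Longrightarrow> A \<subseteq> B \<Longrightarrow> B \<in> \<U>" "\<And>A. A \<in> \<U> \<or> - A \<in> \<U>"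
    have G_in: "G A \<C> N \<in> \<U>" if "finite A" "finite \<C>" "\<forall>C\<in>\<C>. closed C" for A \<C> N
      using that \<U>(1) unfolding \<B>_def by blast
    \<comment> \<open>\<open>W \<alpha>\<close> is the image of \<open>\<U>\<close> under evaluation
      at \<open>\<alpha>\<close>, so the ultrafilter properties carry over.\<close>
    define W where "W \<alpha> = {X. {y. y \<alpha> \<in> X} \<in> \<U>}" for \<alpha>
    show thesis
    proof (rule that[of W Z])
      fix \<alpha> \<beta> :: "nat set" and X Y C :: "'a set" and N :: nat
      show "{} \<notin> W \<alpha>" using \<U>(2) by (simp add: W_def)
      show "X \<inter> Y \<in> W \<alpha>" if "X \<in> W \<alpha>" "Y \<in> W \<alpha>"
        using \<U>(3)[of "{y. y \<alpha> \<in> X}" "{y. y \<alpha> \<in> Y}"] that by (simp add: W_def Int_def)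
      show "Y \<in> W \<alpha>" if "X \<in> W \<alpha>" "X \<subseteq> Y"
        using \<U>(4)[of "{y. y \<alpha> \<in> X}" "{y. y \<alpha> \<in> Y}"] that by (auto simp: W_def)
      show "X \<in> W \<alpha> \<or> - X \<in> W \<alpha>"
        using \<U>(5)[of "{y. y \<alpha> \<in> X}"] by (simp add: W_def Compl_eq)
      show "C \<in> W \<beta>" if "lt \<alpha> \<beta>" "closed C" "C \<in> W \<alpha>"
      proof -
        have "G {\<alpha>, \<beta>} {C} 0 \<inter> {y. y \<alpha> \<in> C} \<in> \<U>" using G_in \<U>(3) that by (simp add: W_def)
        moreover have "G {\<alpha>, \<beta>} {C} 0 \<inter> {y. y \<alpha> \<in> C} \<subseteq> {y. y \<beta> \<in> C}"
          using that(1) by (auto simp: G_def)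
        ultimately show ?thesis using \<U>(4) by (simp add: W_def)
      qed
      show "closed (Z \<alpha>)" by (rule closed_Z)
      have "G {\<alpha>} {} N \<in> \<U>" using G_in by simp
      moreover have "G {\<alpha>} {} N \<subseteq> {y. y \<alpha> \<in> Z \<alpha>}" "G {\<alpha>} {} N \<subseteq> {y. y \<alpha> \<in> (\<Union>n\<in>{N..}. B n)}"
        by (auto simp: G_def)
      ultimately show "Z \<alpha> \<in> W \<alpha>" "(\<Union>n\<in>{N..}. B n) \<in> W \<alpha>"
        using \<U>(4) unfolding W_def by blast+
      show "Z \<beta> \<notin> W \<alpha>" if "lt \<alpha> \<beta>"
      proof
        assume "Z \<beta> \<in> W \<alpha>"
        then have "G {\<alpha>, \<beta>} {} 0 \<inter> {y. y \<alpha> \<in> Z \<beta>} \<in> \<U>" using G_in \<U>(3) by (simp add: W_def)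
        moreover have "G {\<alpha>, \<beta>} {} 0 \<inter> {y. y \<alpha> \<in> Z \<beta>} = {}" using that by (auto simp: G_def)
        ultimately show False using \<U>(2) by simp
      qed
    qed
  qed
qed

end

section \<open>Ideals of functions vanishing at infinity\<close>

text \<open>Superlevel sets are closed by continuity, so enclosing them in compact sets is
  enough.\<close>

lemma C_0I:
  fixes f :: "'a::topological_space \<Rightarrow> 'k::real_normed_field"
  assumes f: "continuous_on UNIV f"
    and K: "\<And>\<epsilon>. \<epsilon> > 0 \<Longrightarrow> \<exists>K. compact K \<and> {x. norm (f x) \<ge> \<epsilon>} \<subseteq> K"
  shows "f \<in> C_0"
proof -
  have "compact {x. norm (f x) \<ge> \<epsilon>}" if \<epsilon>: "\<epsilon> > 0" for \<epsilon>
  proof -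
    obtain K where K: "compact K" "{x. norm (f x) \<ge> \<epsilon>} \<subseteq> K" using K[OF \<epsilon>] by blast
    have "closed {x. norm (f x) \<ge> \<epsilon>}"
      by (intro closed_Collect_le continuous_intros f)
    then have "compact (K \<inter> {x. norm (f x) \<ge> \<epsilon>})" by (rule compact_Int_closed[OF K(1)])
    then show ?thesis using K(2) by (simp add: Int_absorb1)
  qed
  then show ?thesis using f by (simp add: C_0_def C_all_def)
qed

lemma C_0_continuous: "f \<in> C_0 \<Longrightarrow> continuous_on UNIV f"
  by (simp add: C_0_def C_all_def)

lemma C_0_compact: "f \<in> C_0 \<Longrightarrow> \<epsilon> > 0 \<Longrightarrow> compact {x. norm (f x) \<ge> \<epsilon>}"
  by (simp add: C_0_def)

lemma C_0_add:
  assumes "f \<in> C_0" "g \<in> C_0" shows "(\<lambda>x. f x + g x) \<in> C_0"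
proof (rule C_0I)
  show "continuous_on UNIV (\<lambda>x. f x + g x)" by (intro continuous_intros C_0_continuous assms)
  fix \<epsilon> :: real assume "\<epsilon> > 0"
  have "norm (f x) \<ge> \<epsilon>/2 \<or> norm (g x) \<ge> \<epsilon>/2" if "norm (f x + g x) \<ge> \<epsilon>" for x
    using that norm_triangle_ineq[of "f x" "g x"] by linarith
  then have "{x. norm (f x + g x) \<ge> \<epsilon>} \<subseteq> {x. norm (f x) \<ge> \<epsilon>/2} \<union> {x. norm (g x) \<ge> \<epsilon>/2}" by blast
  moreover have "compact ({x. norm (f x) \<ge> \<epsilon>/2} \<union> {x. norm (g x) \<ge> \<epsilon>/2})"
    using \<open>\<epsilon> > 0\<close> by (intro compact_Un C_0_compact assms) auto
  ultimately show "\<exists>K. compact K \<and> {x. norm (f x + g x) \<ge> \<epsilon>} \<subseteq> K" by blast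
qed

lemma C_0_mult_bounded:
  assumes f: "f \<in> C_0" and g: "continuous_on UNIV g" and M: "\<And>x. norm (g x) \<le> M"
  shows "(\<lambda>x. f x * g x) \<in> C_0"
proof (rule C_0I)
  show "continuous_on UNIV (\<lambda>x. f x * g x)" by (intro continuous_intros C_0_continuous f g)
  fix \<epsilon> :: real assume \<epsilon>: "\<epsilon> > 0"
  \<comment> \<open>The bound \<open>M\<close> may be 0, and a positive divisor is required.\<close>
  define N where "N = max M 1"
  have N: "N > 0" "\<And>x. norm (g x) \<le> N" using M by (auto simp: N_def le_max_iff_disj)
  have "\<epsilon> / N \<le> norm (f x)" if "norm (f x * g x) \<ge> \<epsilon>" for x
  proof -
    have "\<epsilon> \<le> norm (f x) * norm (g x)" using that by (simp add: norm_mult)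
    also have "\<dots> \<le> norm (f x) * N" using N(2) by (intro mult_left_mono) auto
    finally show ?thesis using N(1) by (simp add: divide_le_eq)
  qed
  then have "{x. norm (f x * g x) \<ge> \<epsilon>} \<subseteq> {x. norm (f x) \<ge> \<epsilon> / N}" by blast
  then show "\<exists>K. compact K \<and> {x. norm (f x * g x) \<ge> \<epsilon>} \<subseteq> K"
    using C_0_compact[OF f, of "\<epsilon> / N"] \<epsilon> N(1) by auto
qed

text \<open>Continuity gives a bound on the compact set where the norm is at least 1; elsewhere 1 is
  a bound.\<close>

lemma C_0_bounded:
  fixes g :: "'a::topological_space \<Rightarrow> 'k::real_normed_field"
  assumes "g \<in> C_0" obtains M where "\<And>x. norm (g x) \<le> M"
proof -
  have "compact ((\<lambda>x. norm (g x)) ` {x. norm (g x) \<ge> 1})"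
    using continuous_on_subset[OF C_0_continuous[OF assms]]
    by (intro compact_continuous_image continuous_intros C_0_compact assms) auto
  then obtain M where M: "\<And>y. y \<in> (\<lambda>x. norm (g x)) ` {x. norm (g x) \<ge> 1} \<Longrightarrow> norm y \<le> M"
    using compact_imp_bounded bounded_iff by metis
  have "norm (g x) \<le> max M 1" for x using M[of "norm (g x)"] by (cases "norm (g x) \<ge> 1") auto
  then show thesis by (rule that)
qed

lemma C_0_mult:
  assumes "f \<in> C_0" "g \<in> C_0" shows "(\<lambda>x. f x * g x) \<in> C_0"
proof -
  obtain M where "\<And>x. norm (g x) \<le> M" using C_0_bounded[OF assms(2)] by blast
  then show ?thesis by (rule C_0_mult_bounded[OF assms(1) C_0_continuous[OF assms(2)]])
qed

text \<open>The function \<open>u\<close> keeps the ideal proper, since a prime z-filter may contain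
  the zero sets of all functions in \<open>C_0\<close>. Primeness holds because the zero set of a
  product is the union of the zero sets.\<close>

lemma prime_z_ideal_of_prime_z_filter:
  fixes F :: "'a::topological_space set set"
  assumes F: "prime_z_filter TYPE('k::real_normed_field) F"
    and u: "u \<in> C_0" "zero_set (u :: 'a \<Rightarrow> 'k) \<notin> F"
  defines "I \<equiv> C_0 \<inter> zero_set_preimage F :: ('a \<Rightarrow> 'k) set"
  shows "C_0_prime_ideal I" "C_0_z_ideal I"
proof -
  have zs: "zero_set f \<in> zero_sets TYPE('k)" if "f \<in> C_0" for f :: "'a \<Rightarrow> 'k"
    using that by (auto simp: zero_sets_def C_0_def)
  have I_iff: "f \<in> I \<longleftrightarrow> f \<in> C_0 \<and> zero_set f \<in> F" for f
    by (auto simp: I_def zero_set_preimage_def C_0_def)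
  have up: "Z2 \<in> F" if "Z1 \<in> F" "Z2 \<in> zero_sets TYPE('k)" "Z1 \<subseteq> Z2" for Z1 Z2
    using F that unfolding prime_z_filter_def z_filter_def by metis
  have int: "Z1 \<inter> Z2 \<in> F" if "Z1 \<in> F" "Z2 \<in> F" for Z1 Z2
    using F that unfolding prime_z_filter_def z_filter_def by metis
  have prime: "Z1 \<in> F \<or> Z2 \<in> F"
    if "Z1 \<union> Z2 \<in> F" "Z1 \<in> zero_sets TYPE('k)" "Z2 \<in> zero_sets TYPE('k)" for Z1 Z2
    using F that unfolding prime_z_filter_def by (meson DiffI)
  have z_closed: "g \<in> I" if "f \<in> I" "g \<in> C_0" "zero_set f \<subseteq> zero_set g" for f g
    using up[OF _ zs that(3)] that by (auto simp: I_iff)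
  obtain Z0 where Z0: "Z0 \<in> F" using F unfolding prime_z_filter_def z_filter_def by blast
  have zero: "(\<lambda>x. 0) \<in> C_0"
    by (rule C_0I) (auto intro!: exI[of _ "{}"])
  then have "(\<lambda>x. 0) \<in> I" using up[OF Z0 zs[OF zero]] by (auto simp: I_iff zero_set_def)
  moreover have "(\<lambda>x. f x + g x) \<in> I" if "f \<in> I" "g \<in> I" for f g
  proof -
    have "(\<lambda>x. f x + g x) \<in> C_0" using that by (intro C_0_add) (auto simp: I_iff)
    moreover have "zero_set f \<inter> zero_set g \<subseteq> zero_set (\<lambda>x. f x + g x)" by (auto simp: zero_set_def)
    ultimately show ?thesis using up[OF int zs] that by (auto simp: I_iff)
  qed
  moreover have "(\<lambda>x. c * f x) \<in> I" if "f \<in> I" for c f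
  proof (rule z_closed[OF that])
    have "(\<lambda>x. f x * c) \<in> C_0"
      using that by (intro C_0_mult_bounded[where M="norm c"]) (auto simp: I_iff)
    then show "(\<lambda>x. c * f x) \<in> C_0" by (simp add: mult.commute)
  qed (auto simp: zero_set_def)
  moreover have "(\<lambda>x. f x * g x) \<in> I" if "f \<in> I" "g \<in> C_0" for f g
    using that by (intro z_closed[OF that(1)] C_0_mult) (auto simp: I_iff zero_set_def)
  ultimately have "C_0_ideal I" unfolding C_0_ideal_def by (auto simp: I_def)
  moreover have "I \<noteq> C_0" using u by (auto simp: I_iff)
  moreover have "f \<in> I \<or> g \<in> I" if "f \<in> C_0" "g \<in> C_0" "(\<lambda>x. f x * g x) \<in> I" for f g
  proof -
    have "zero_set (\<lambda>x. f x * g x) = zero_set f \<union> zero_set g" by (auto simp: zero_set_def)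
    then show ?thesis using prime[OF _ zs zs] that by (auto simp: I_iff)
  qed
  ultimately show "C_0_prime_ideal I" "C_0_z_ideal I"
    using z_closed unfolding C_0_prime_ideal_def C_0_z_ideal_def by blast+
qed

context metrized_space
begin

text \<open>Exchanging \<open>x\<close> and \<open>y\<close> turns the one-sided inequality into the
  1-Lipschitz condition for \<open>d\<close>.\<close>

lemma continuous_on_Lipschitz:
  fixes f :: "'a \<Rightarrow> real"
  assumes "\<And>x y. f x \<le> d x y + f y"
  shows "continuous_on UNIV f"
  unfolding continuous_on_open_vimage[OF open_UNIV]
proof (intro allI impI)
  fix V :: "real set" assume "open V"
  have "\<exists>r>0. mball x r \<subseteq> f -` V \<inter> UNIV" if "x \<in> f -` V \<inter> UNIV" for x
  proof -
    have "f x \<in> V" using that by simp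
    then have "\<exists>e>0. \<forall>t. dist t (f x) < e \<longrightarrow> t \<in> V"
      using \<open>open V\<close> by (simp add: open_dist)
    then obtain e where e: "e > 0" "\<forall>t. dist t (f x) < e \<longrightarrow> t \<in> V" by blast
    have "f y \<in> V" if "d x y < e" for y
      using e(2)[rule_format, of "f y"] assms[of x y] assms[of y x] that commute[of x y]
      by (auto simp: dist_real_def abs_less_iff)
    then show ?thesis using e(1) by (intro exI[of _ e]) auto
  qed
  then show "open (f -` V \<inter> UNIV)" unfolding open_iff by blast
qed

lemma continuous_on_inf_distance: "T \<noteq> {} \<Longrightarrow> continuous_on UNIV (inf_distance T)"
  by (intro continuous_on_Lipschitz inf_distance_triangle)

lemma continuous_on_distance: "continuous_on UNIV (d a)"
proof (rule continuous_on_Lipschitz)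
  show "d a x \<le> d x y + d a y" for x y using triangle[of a y x] commute[of x y] by simp
qed

text \<open>A nonempty closed set is the zero set of the distance to it; the empty set is that of
  the constant 1.\<close>

lemma zero_sets_eq_closed: "zero_sets TYPE('k::real_normed_field) = {C :: 'a set. closed C}"
proof (intro equalityI subsetI)
  fix C :: "'a set" assume "C \<in> zero_sets TYPE('k)"
  then obtain f :: "'a \<Rightarrow> 'k" where "continuous_on UNIV f" "C = {x. f x = 0}"
    by (auto simp: zero_sets_def C_all_def zero_set_def)
  then show "C \<in> {C. closed C}" by (auto intro!: closed_Collect_eq continuous_intros)
next
  fix C :: "'a set" assume "C \<in> {C. closed C}"
  then have C: "closed C" by simp
  show "C \<in> zero_sets TYPE('k)"
  proof (cases "C = {}")
    case True
    have "zero_set (\<lambda>_. 1 :: 'k) = C" "(\<lambda>_. 1 :: 'k) \<in> C_all" by (auto simp: zero_set_def True C_all_def)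
    then show ?thesis unfolding zero_sets_def by blast
  next
    case False
    then have "zero_set (\<lambda>x. of_real (inf_distance C x) :: 'k) = C"
      using inf_distance_eq_0 C by (auto simp: zero_set_def)
    moreover have "(\<lambda>x. of_real (inf_distance C x) :: 'k) \<in> C_all"
      using continuous_on_inf_distance[OF False] by (auto simp: C_all_def intro!: continuous_intros)
    ultimately show ?thesis unfolding zero_sets_def by blast
  qed
qed

end

section \<open>A function vanishing at infinity and positive on all balls\<close>

context ball_sequence
begin

text \<open>This is a supremum of tents over the balls. The factors \<open>1 / Suc n\<close> leave
  only finitely many tents above any positive height, which makes the function vanish at
  infinity.\<close>

definition bump :: "'a \<Rightarrow> real" where
  "bump y = (SUP n. max 0 (r n - d (x n) y) / Suc n)"

lemma bump_term_le: "max 0 (r n - d (x n) y) / Suc n \<le> 1 / Suc n"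
proof (rule divide_right_mono)
  show "max 0 (r n - d (x n) y) \<le> 1" using r_le_1[of n] nonneg[of "x n" y] by linarith
qed simp

lemma bump_term_le_bump: "max 0 (r n - d (x n) y) / Suc n \<le> bump y"
  unfolding bump_def
proof (rule cSUP_upper)
  have "1 / real (Suc n) \<le> 1" for n by simp
  then show "bdd_above (range (\<lambda>n. max 0 (r n - d (x n) y) / Suc n))"
    using bump_term_le by (intro bdd_aboveI2[of _ _ 1]) (meson order_trans)
qed simp

lemma bump_nonneg: "0 \<le> bump y"
  using bump_term_le_bump[of 0 y] by (simp add: max_def split: if_splits)

lemma bump_pos: "y \<in> B n \<Longrightarrow> 0 < bump y"
  using bump_term_le_bump[of n y] by (auto simp: max_def split: if_splits elim!: less_le_trans[rotated])

text \<open>Each scaled tent is 1-Lipschitz, and suprema inherit this.\<close>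

lemma continuous_on_bump: "continuous_on UNIV bump"
proof (rule continuous_on_Lipschitz)
  fix y z
  have "max 0 (r n - d (x n) y) / Suc n \<le> d y z + bump z" for n
  proof -
    have "d (x n) z \<le> d (x n) y + d y z" using triangle by simp
    then have "max 0 (r n - d (x n) y) \<le> d y z + max 0 (r n - d (x n) z)"
      using nonneg[of y z] by linarith
    then have "max 0 (r n - d (x n) y) / Suc n \<le> (d y z + max 0 (r n - d (x n) z)) / Suc n"
      by (intro divide_right_mono) auto
    also have "\<dots> = d y z / Suc n + max 0 (r n - d (x n) z) / Suc n" by (rule add_divide_distrib)
    also have "\<dots> \<le> d y z + bump z"
      using bump_term_le_bump[of n z] divide_left_mono[of 1 "real (Suc n)" "d y z"]
      by (intro add_mono) simp_all
    finally show ?thesis .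
  qed
  then show "bump y \<le> d y z + bump z" unfolding bump_def[of y] by (intro cSUP_least) auto
qed

text \<open>If \<open>1 / Suc N < \<epsilon>\<close>, the tents from \<open>N\<close> on stay below
  \<open>\<epsilon>\<close>, so the superlevel set lies in the first \<open>N\<close> closed balls,
  which are compact.\<close>

lemma bump_superlevel_compact:
  assumes "\<epsilon> > 0" shows "\<exists>K. compact K \<and> {y. bump y \<ge> \<epsilon>} \<subseteq> K"
proof -
  obtain N where N: "1 / Suc N < \<epsilon>" using assms nat_approx_posE by blast
  have "y \<in> (\<Union>n<N. mcball (x n) (r n))" if "bump y \<ge> \<epsilon>" for y
  proof (rule ccontr)
    assume y: "y \<notin> (\<Union>n<N. mcball (x n) (r n))"
    have "max 0 (r n - d (x n) y) / Suc n \<le> 1 / Suc N" for n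
    proof (cases "n < N")
      case True
      then have "r n < d (x n) y" using y by (auto simp: not_le)
      then show ?thesis by simp
    next
      case False
      then have "1 / real (Suc n) \<le> 1 / Suc N" by (simp add: frac_le)
      then show ?thesis using bump_term_le[of n y] by linarith
    qed
    then have "bump y \<le> 1 / Suc N" unfolding bump_def by (intro cSUP_least) auto
    then show False using that N by simp
  qed
  moreover have "compact (\<Union>n<N. mcball (x n) (r n))" using compact_mcball by (intro compact_UN) auto
  ultimately show ?thesis by blast
qed

lemma of_real_bump_C_0: "(\<lambda>y. of_real (bump y) :: 'k::real_normed_field) \<in> C_0"
proof (rule C_0I)
  show "continuous_on UNIV (\<lambda>y. of_real (bump y) :: 'k)" by (intro continuous_intros continuous_on_bump)
qed (use bump_superlevel_compact bump_nonneg in simp)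

end

section \<open>The chain\<close>

lemma (in ball_sequence) ex_chain:
  fixes lt :: "nat set \<Rightarrow> nat set \<Rightarrow> bool"
  assumes irrefl: "\<And>\<alpha>. \<not> lt \<alpha> \<alpha>" and trans: "\<And>\<alpha> \<beta> \<gamma>. lt \<alpha> \<beta> \<Longrightarrow> lt \<beta> \<gamma> \<Longrightarrow> lt \<alpha> \<gamma>"
  shows "\<exists>Q :: nat set \<Rightarrow> 'a set set.
    (\<forall>\<alpha>. prime_z_filter TYPE('k::real_normed_field) (Q \<alpha>) \<and> filter_supported_at (Q \<alpha>) p \<and>
      C_0_prime_ideal (C_0 \<inter> zero_set_preimage (Q \<alpha>) :: ('a \<Rightarrow> 'k) set) \<and>
      C_0_z_ideal (C_0 \<inter> zero_set_preimage (Q \<alpha>) :: ('a \<Rightarrow> 'k) set) \<and>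
      ideal_supported_at (C_0 \<inter> zero_set_preimage (Q \<alpha>) :: ('a \<Rightarrow> 'k) set) p) \<and>
    (\<forall>\<alpha> \<beta>. lt \<alpha> \<beta> \<longrightarrow> Q \<alpha> \<subset> Q \<beta> \<and>
      C_0 \<inter> zero_set_preimage (Q \<alpha>) \<subset> (C_0 \<inter> zero_set_preimage (Q \<beta>) :: ('a \<Rightarrow> 'k) set))"
proof (rule ex_ultrafilters[OF irrefl trans])
  fix W :: "nat set \<Rightarrow> 'a set set" and Z
  assume empty: "\<And>\<alpha>. {} \<notin> W \<alpha>"
    and int: "\<And>\<alpha> X Y. X \<in> W \<alpha> \<Longrightarrow> Y \<in> W \<alpha> \<Longrightarrow> X \<inter> Y \<in> W \<alpha>"
    and up: "\<And>\<alpha> X Y. X \<in> W \<alpha> \<Longrightarrow> X \<subseteq> Y \<Longrightarrow> Y \<in> W \<alpha>"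
    and ultra: "\<And>\<alpha> X. X \<in> W \<alpha> \<or> - X \<in> W \<alpha>"
    and mono: "\<And>\<alpha> \<beta> C. lt \<alpha> \<beta> \<Longrightarrow> closed C \<Longrightarrow> C \<in> W \<alpha> \<Longrightarrow> C \<in> W \<beta>"
    and Z: "\<And>\<alpha>. closed (Z \<alpha>)" "\<And>\<alpha>. Z \<alpha> \<in> W \<alpha>" "\<And>\<alpha> \<beta>. lt \<alpha> \<beta> \<Longrightarrow> Z \<beta> \<notin> W \<alpha>"
    and tail: "\<And>\<alpha> N. (\<Union>n\<in>{N..}. B n) \<in> W \<alpha>"
  define Q where "Q \<alpha> = {C. closed C \<and> C \<in> W \<alpha>}" for \<alpha>
  define I where "I \<alpha> = (C_0 \<inter> zero_set_preimage (Q \<alpha>) :: ('a \<Rightarrow> 'k) set)" for \<alpha>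
  define u where "u = (\<lambda>y. of_real (bump y) :: 'k)"
  have u: "u \<in> C_0" unfolding u_def by (rule of_real_bump_C_0)
  have u_nz: "u y \<noteq> 0" if "y \<in> B n" for y n using bump_pos[OF that] by (simp add: u_def)
  have zs: "closed (zero_set f)" if "f \<in> C_0" for f :: "'a \<Rightarrow> 'k"
    unfolding zero_set_def by (intro closed_Collect_eq continuous_intros C_0_continuous that)
  have I_iff: "f \<in> I \<alpha> \<longleftrightarrow> f \<in> C_0 \<and> zero_set f \<in> W \<alpha>" for f \<alpha>
    using zs by (auto simp: I_def Q_def zero_set_preimage_def C_0_def)
  have contra: False if "X \<in> W \<alpha>" "Y \<in> W \<alpha>" "X \<inter> Y = {}" for X Y \<alpha>
    using int[OF that(1,2)] that(3) empty by simp
  have prime_Q: "prime_z_filter TYPE('k) (Q \<alpha>)" for \<alpha>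
    unfolding prime_z_filter_def z_filter_def zero_sets_eq_closed
  proof (intro conjI ballI impI)
    have "UNIV \<in> Q \<alpha>" using up[OF Z(2)] by (auto simp: Q_def)
    then show "Q \<alpha> \<noteq> {}" by blast
    have "{} \<notin> Q \<alpha>" using empty by (simp add: Q_def)
    then show "Q \<alpha> \<subset> {C. closed C}" by (auto simp: Q_def)
    show "X \<inter> Y \<in> Q \<alpha>" if "X \<in> Q \<alpha>" "Y \<in> Q \<alpha>" for X Y
      using that int by (auto simp: Q_def)
    show "Y \<in> Q \<alpha>" if "X \<in> Q \<alpha>" "Y \<in> {C. closed C}" "X \<subseteq> Y" for X Y
      using that up by (auto simp: Q_def)
    show "X \<union> Y \<notin> Q \<alpha>" if "X \<in> {C. closed C} - Q \<alpha>" "Y \<in> {C. closed C} - Q \<alpha>" for X Y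
    proof
      assume XY: "X \<union> Y \<in> Q \<alpha>"
      have "- X \<in> W \<alpha>" "- Y \<in> W \<alpha>" using that ultra by (auto simp: Q_def)
      then have "- X \<inter> - Y \<in> W \<alpha>" by (rule int)
      then show False using XY contra[of "X \<union> Y" \<alpha> "- X \<inter> - Y"] by (auto simp: Q_def)
    qed
  qed
  \<comment> \<open>The union of all balls belongs to \<open>W \<alpha>\<close>, and
    \<open>u\<close> has no zero there. This is what makes the ideals proper.\<close>
  have "zero_set u \<notin> Q \<alpha>" for \<alpha>
  proof
    assume "zero_set u \<in> Q \<alpha>"
    then have "zero_set u \<in> W \<alpha>" by (simp add: Q_def)
    moreover have "zero_set u \<inter> (\<Union>n\<in>{0..}. B n) = {}"
      using u_nz unfolding zero_set_def by blast
    ultimately show False by (rule contra[OF _ tail])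
  qed
  then have prime_I: "C_0_prime_ideal (I \<alpha>)" "C_0_z_ideal (I \<alpha>)" for \<alpha>
    unfolding I_def using prime_z_ideal_of_prime_z_filter[OF prime_Q u] by blast+
  \<comment> \<open>Some tail of the balls misses \<open>mball y c\<close>, and every tail belongs
    to \<open>W \<alpha>\<close>.\<close>
  have away: "- mball y c \<in> W \<alpha>" if c: "finite {n. B n \<inter> mball y c \<noteq> {}}" for y c \<alpha>
  proof -
    obtain N where N: "\<And>n. B n \<inter> mball y c \<noteq> {} \<Longrightarrow> n < N"
      using c by (metis (mono_tags, lifting) finite_nat_set_iff_bounded mem_Collect_eq)
    have "B n \<inter> mball y c = {}" if "n \<ge> N" for n
    proof (rule ccontr)
      assume "B n \<inter> mball y c \<noteq> {}"
      from N[OF this] that show False by simp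
    qed
    then have "(\<Union>n\<in>{N..}. B n) \<subseteq> - mball y c" by fastforce
    then show ?thesis by (rule up[OF tail])
  qed
  have supp_Q: "filter_supported_at (Q \<alpha>) p" and supp_I: "ideal_supported_at (I \<alpha>) p" for \<alpha>
  proof -
    have "filter_supported_at (Q \<alpha>) p \<and> ideal_supported_at (I \<alpha>) p"
    proof (cases p)
      case (Some q)
      have q: "q \<in> C" if "closed C" "C \<in> W \<alpha>" for C
      proof (rule ccontr)
        assume "q \<notin> C"
        then obtain N where N: "\<forall>n\<ge>N. B n \<subseteq> - C"
          using balls_tend_to_point[OF Some, of "- C"] \<open>closed C\<close> by (auto simp: closed_def)
        then have "C \<inter> (\<Union>n\<in>{N..}. B n) = {}" by blast
        then show False by (rule contra[OF that(2) tail])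
      qed
      then have "f q = 0" if "f \<in> I \<alpha>" for f
        using that zs[of f] by (auto simp: I_iff zero_set_def)
      then show ?thesis using q by (auto simp: Some Q_def)
    next
      case None
      have near: "\<exists>c>0. compact (mcball y c) \<and> - mball y c \<in> W \<alpha>" for y
      proof -
        obtain c1 where c1: "c1 > 0" "finite {n. B n \<inter> mball y c1 \<noteq> {}}"
          using balls_locally_finite[of y] None by auto
        obtain c2 where c2: "c2 > 0" "compact (mcball y c2)" using ex_compact_mcball by blast
        define c where "c = min c1 c2"
        have "mcball y c = mcball y c2 \<inter> mcball y c" by (auto simp: c_def)
        then have "compact (mcball y c)" using compact_Int_closed[OF c2(2) closed_mcball] by metis
        moreover have "- mball y c \<in> W \<alpha>" by (rule up[OF away[OF c1(2)]]) (auto simp: c_def)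
        ultimately show ?thesis using c1 c2 by (intro exI[of _ c]) (auto simp: c_def)
      qed
      have "\<exists>C\<in>Q \<alpha>. y \<notin> C" for y
      proof -
        obtain c where c: "c > 0" "- mball y c \<in> W \<alpha>" using near by blast
        then show ?thesis by (intro bexI[of _ "- mball y c"]) (auto simp: Q_def closed_def)
      qed
      moreover have "\<exists>f\<in>I \<alpha>. f y \<noteq> 0" for y
      proof -
        obtain c where c: "c > 0" "compact (mcball y c)" "- mball y c \<in> W \<alpha>" using near by blast
        \<comment> \<open>A tent around \<open>y\<close> has support inside a compact ball and
          vanishes on a member of \<open>W \<alpha>\<close>, so it is in the ideal although
          \<open>f y\<close> is not 0.\<close>
        define f where "f = (\<lambda>z. of_real (max 0 (c - d y z)) :: 'k)"
        have "f \<in> C_0"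
        proof (rule C_0I)
          show "continuous_on UNIV f"
            unfolding f_def by (intro continuous_intros continuous_on_distance)
          have "{z. norm (f z) \<ge> \<epsilon>} \<subseteq> mcball y c" if "\<epsilon> > 0" for \<epsilon>
            using that by (auto simp: f_def)
          then show "\<exists>K. compact K \<and> {z. norm (f z) \<ge> \<epsilon>} \<subseteq> K" if "\<epsilon> > 0" for \<epsilon>
            using that c(2) by blast
        qed
        moreover have "- mball y c \<subseteq> zero_set f" by (auto simp: f_def zero_set_def)
        ultimately have "f \<in> I \<alpha>" using up[OF c(3)] by (simp add: I_iff)
        moreover have "f y \<noteq> 0" using c(1) by (simp add: f_def)
        ultimately show ?thesis by blast
      qed
      ultimately show ?thesis by (auto simp: None)
    qed
    then show "filter_supported_at (Q \<alpha>) p" "ideal_supported_at (I \<alpha>) p" by auto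
  qed
  have Q_less: "Q \<alpha> \<subset> Q \<beta>" and I_less: "I \<alpha> \<subset> I \<beta>" if lt: "lt \<alpha> \<beta>" for \<alpha> \<beta>
  proof -
    have "Q \<alpha> \<subseteq> Q \<beta>" using mono[OF lt] by (auto simp: Q_def)
    moreover have "Z \<beta> \<in> Q \<beta> - Q \<alpha>" using Z lt by (auto simp: Q_def)
    ultimately show "Q \<alpha> \<subset> Q \<beta>" by blast
    then have "I \<alpha> \<subseteq> I \<beta>" by (auto simp: I_def zero_set_preimage_def)
    moreover have "\<exists>f. f \<in> I \<beta> \<and> f \<notin> I \<alpha>"
    proof -
      have ne: "Z \<beta> \<noteq> {}" using Z(2)[of \<beta>] empty[of \<beta>] by auto
      \<comment> \<open>The distance is capped to be bounded, so that multiplying by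
        \<open>u\<close> gives a function in \<open>C_0\<close>. As \<open>u\<close> has no zeros on
        the balls, the product vanishes there exactly on \<open>Z \<beta>\<close>, which is in
        \<open>W \<beta>\<close> but not in \<open>W \<alpha>\<close>.\<close>
      define g where "g = (\<lambda>y. of_real (min 1 (inf_distance (Z \<beta>) y)) :: 'k)"
      have g0: "g y = 0 \<longleftrightarrow> y \<in> Z \<beta>" for y
        using inf_distance_eq_0[OF ne Z(1), of y] by (auto simp: g_def min_def)
      have "continuous_on UNIV g"
        unfolding g_def by (intro continuous_intros continuous_on_inf_distance ne)
      moreover have "norm (g y) \<le> 1" for y
        using inf_distance_nonneg[OF ne, of y] by (simp add: g_def)
      ultimately have f: "(\<lambda>y. u y * g y) \<in> C_0" by (rule C_0_mult_bounded[OF u])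
      have "Z \<beta> \<subseteq> zero_set (\<lambda>y. u y * g y)" using g0 by (auto simp: zero_set_def)
      then have "(\<lambda>y. u y * g y) \<in> I \<beta>" using f up[OF Z(2)] by (simp add: I_iff)
      moreover have "(\<lambda>y. u y * g y) \<notin> I \<alpha>"
      proof
        assume "(\<lambda>y. u y * g y) \<in> I \<alpha>"
        then have "zero_set (\<lambda>y. u y * g y) \<inter> (\<Union>n\<in>{0..}. B n) \<in> W \<alpha>"
          by (intro int tail) (simp add: I_iff)
        moreover have "zero_set (\<lambda>y. u y * g y) \<inter> (\<Union>n\<in>{0..}. B n) \<subseteq> Z \<beta>"
          using u_nz g0 by (auto simp: zero_set_def simp del: in_mball)
        ultimately have "Z \<beta> \<in> W \<alpha>" by (rule up)
        then show False using Z(3)[OF lt] by blast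
      qed
      ultimately show ?thesis by blast
    qed
    ultimately show "I \<alpha> \<subset> I \<beta>" by blast
  qed
  show ?thesis
    using prime_Q supp_Q prime_I supp_I Q_less I_less unfolding I_def
    by (intro exI[of _ Q] conjI allI impI)
qed

section \<open>From the topological hypotheses to the metric construction\<close>

theorem theorem5p4:
  fixes p :: "'a::topological_space option"
  assumes "metrizable_space (euclidean :: 'a topology)"
    and "locally_compact_space (euclidean :: 'a topology)"
    and "p \<in> limit_points_inf (Alexandroff_compactification (euclidean :: 'a topology))"
  shows "\<exists>\<Q> :: nat set \<Rightarrow> 'a set set.
    increasing_chain continuum_ordinal \<Q> \<and>
    (\<forall>\<alpha>\<in>Field continuum_ordinal.
       prime_z_filter TYPE('k::real_normed_field) (\<Q> \<alpha>) \<and> filter_supported_at (\<Q> \<alpha>) p) \<and>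
    (let Q = (\<lambda>\<alpha>. C_0 \<inter> zero_set_preimage (\<Q> \<alpha>) :: ('a \<Rightarrow> 'k) set) in
       increasing_chain continuum_ordinal Q \<and>
       (\<forall>\<alpha>\<in>Field continuum_ordinal.
          C_0_prime_ideal (Q \<alpha>) \<and> C_0_z_ideal (Q \<alpha>) \<and> ideal_supported_at (Q \<alpha>) p))"
proof -
  obtain M and d :: "'a \<Rightarrow> 'a \<Rightarrow> real"
    where Md: "Metric_space M d" "euclidean = Metric_space.mtopology M d"
    using assms(1) unfolding metrizable_space_def by blast
  have "M = UNIV" using Metric_space.topspace_mtopology[OF Md(1)] by (simp flip: Md(2))
  then interpret metrized_space d
    using Md by (simp add: metrized_space_def metrized_space_axioms_def)
  have "\<exists>c>0. compact (mcball y c)" for y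
  proof -
    obtain U K where UK: "open U" "compact K" "y \<in> U" "U \<subseteq> K"
      using assms(2) by (simp add: locally_compact_space_def) blast
    then obtain c where c: "c > 0" "mcball y c \<subseteq> U"
      using open_iff[of U] mball_iff_mcball[of y U] by blast
    \<comment> \<open>A closed ball inside a compact neighbourhood is a closed part of a compact
      set.\<close>
    then have "mcball y c = K \<inter> mcball y c" using UK(4) by blast
    then have "compact (mcball y c)" using compact_Int_closed[OF UK(2) closed_mcball] by metis
    then show ?thesis using c(1) by blast
  qed
  then interpret locally_compact_metrized_space d by unfold_locales
  obtain x r where "ball_sequence d p x r" using ex_ball_sequence[OF assms(3)] .
  then interpret ball_sequence d p x r .
  \<comment> \<open>The strict part of the well-order of type continuum orders the sets of naturals,
    which are also the indices of the independent functions.\<close>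
  define lt where "lt \<alpha> \<beta> \<longleftrightarrow> (\<alpha>, \<beta>) \<in> continuum_ordinal \<and> \<alpha> \<noteq> \<beta>" for \<alpha> \<beta>
  have wo: "Well_order continuum_ordinal"
    unfolding continuum_ordinal_def by (rule card_of_Well_order)
  have "\<not> lt \<alpha> \<alpha>" for \<alpha> by (simp add: lt_def)
  moreover have "lt \<alpha> \<gamma>" if "lt \<alpha> \<beta>" "lt \<beta> \<gamma>" for \<alpha> \<beta> \<gamma>
    using wo that unfolding lt_def order_on_defs well_order_on_def
    by (metis antisymD transD)
  ultimately obtain \<Q> :: "nat set \<Rightarrow> 'a set set" where \<Q>:
    "(\<forall>\<alpha>. prime_z_filter TYPE('k) (\<Q> \<alpha>) \<and> filter_supported_at (\<Q> \<alpha>) p \<and>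
      C_0_prime_ideal (C_0 \<inter> zero_set_preimage (\<Q> \<alpha>) :: ('a \<Rightarrow> 'k) set) \<and>
      C_0_z_ideal (C_0 \<inter> zero_set_preimage (\<Q> \<alpha>) :: ('a \<Rightarrow> 'k) set) \<and>
      ideal_supported_at (C_0 \<inter> zero_set_preimage (\<Q> \<alpha>) :: ('a \<Rightarrow> 'k) set) p) \<and>
    (\<forall>\<alpha> \<beta>. lt \<alpha> \<beta> \<longrightarrow> \<Q> \<alpha> \<subset> \<Q> \<beta> \<and>
      C_0 \<inter> zero_set_preimage (\<Q> \<alpha>) \<subset> (C_0 \<inter> zero_set_preimage (\<Q> \<beta>) :: ('a \<Rightarrow> 'k) set))"
    using ex_chain[of lt, where ?'k = 'k] by blast
  show ?thesis
    unfolding increasing_chain_def Let_def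
    using \<Q> wo unfolding lt_def by (intro exI[of _ \<Q>]) simp
qed

end
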